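(* Let $n\ge 1$, let $\lambda$ be a partition of $n$ and $\alpha$ a composition of $n$ such that $\alpha$ is not dominated by $\lambda$ (i.e. $\operatorname{Pet}_{\lambda,\alpha}$ is not admissible). Let $(\mathcal{D}_\lambda\cap\mathcal{R}_\alpha)^{\mathrm{crs}}$ be the set of all coarsest elements in the set of compositions of $n$ that are dominated by $\lambda$ and refine $\alpha$. Then $$\operatorname{Pet}_{\lambda,\alpha}=\bigcup_{\beta\in(\mathcal{D}_\lambda\cap\mathcal{R}_\alpha)^{\mathrm{crs}}}\operatorname{Pet}_{\lambda,\beta},$$ and no two varieties in this union are contained within one another (for distinct $\beta,\beta'$ in the index set, $\operatorname{Pet}_{\lambda,\beta}\not\subseteq\operatorname{Pet}_{\lambda,\beta'}$).
   Context: A composition of $n$ is a list $\alpha=(\alpha_1,\ldots,\alpha_\ell)$ of positive integers with sum $n$; its partial sum set is $PS(\alpha)=\{\alpha_1+\cdots+\alpha_j:1\le j\le \ell\}\subseteq[n]$. For compositions of $n$, $\beta$ refines $\alpha$ (written $\beta\preceq\alpha$) if $PS(\alpha)\subseteq PS(\beta)$; $\mathcal{R}_\alpha$ is the set of compositions of $n$ refining $\alpha$. A partition is a weakly decreasing composition. A partition $\lambda$ of $n$ dominates a composition $\alpha$ of $n$ (written $\alpha\unlhd\lambda$) if, for $\mu$ the weakly decreasing rearrangement of $\alpha$, $\mu_1+\cdots+\mu_j\le\lambda_1+\cdots+\lambda_j$ for all $j\ge1$ (entries beyond the length are $0$); $\mathcal{D}_\lambda$ is the set of compositions of $n$ dominated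 by $\lambda$. An element $\beta$ of a set $A$ of compositions of $n$ is coarsest in $A$ if $\beta\not\preceq\gamma$ for every $\gamma\in A$ with $\gamma\neq\beta$; $A^{\mathrm{crs}}$ is the set of coarsest elements of $A$. $N_\lambda$ is an $n\times n$ complex nilpotent matrix in Jordan form of Jordan type $\lambda$. $\operatorname{Fl}(n)$ is the variety of complete flags $F_\bullet=(F_0\subset F_1\subset\cdots\subset F_n=\mathbb{C}^n)$, $\dim F_i=i$. The generalized parabolic Peterson variety is $$\operatorname{Pet}_{\lambda,\alpha}=\{F_\bullet\in\operatorname{Fl}(n): N_\lambda F_i\subset F_i\text{ if }i\in PS(\alpha),\ N_\lambda F_i\subset F_{i+1}\text{ if } i\in[n]\setminus PS(\alpha)\}.$$ It is called admissible if $\alpha\unlhd\lambda$. *)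

theory Defs
  imports "Jordan_Normal_Form.Jordan_Normal_Form" "Jordan_Normal_Form.VS_Connect"
begin

definition is_composition :: "nat \<Rightarrow> nat list \<Rightarrow> bool" where
  "is_composition n a \<longleftrightarrow> (\<forall>x \<in> set a. 0 < x) \<and> sum_list a = n"

definition is_partition :: "nat \<Rightarrow> nat list \<Rightarrow> bool" where
  "is_partition n l \<longleftrightarrow> is_composition n l \<and> sorted_wrt (\<ge>) l"

definition PS :: "nat list \<Rightarrow> nat set" where
  "PS a = {sum_list (take j a) | j. 1 \<le> j \<and> j \<le> length a}"

definition refines :: "nat list \<Rightarrow> nat list \<Rightarrow> bool" where
  "refines b a \<longleftrightarrow> PS a \<subseteq> PS b"

definition refinements :: "nat \<Rightarrow> nat list \<Rightarrow> nat list set" where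
  "refinements n a = {b. is_composition n b \<and> refines b a}"

text \<open>\<^term>\<open>take j\<close> returns the whole list once \<^term>\<open>j\<close> exceeds its length, so
  entries beyond the length count as \<^term>\<open>0::nat\<close>.\<close>

definition dominated_by :: "nat list \<Rightarrow> nat list \<Rightarrow> bool" where
  "dominated_by a l \<longleftrightarrow>
     (\<forall>j \<ge> 1. sum_list (take j (rev (sort a))) \<le> sum_list (take j l))"

definition dominated_set :: "nat \<Rightarrow> nat list \<Rightarrow> nat list set" where
  "dominated_set n l = {b. is_composition n b \<and> dominated_by b l}"

definition coarsest :: "nat list set \<Rightarrow> nat list set" where
  "coarsest A = {b \<in> A. \<forall>c \<in> A. c \<noteq> b \<longrightarrow> \<not> refines b c}"

definition nilpotent_jordan :: "nat list \<Rightarrow> complex mat" where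
  "nilpotent_jordan l = jordan_matrix (map (\<lambda>k. (k, 0)) l)"

definition has_subspace_dim :: "nat \<Rightarrow> complex vec set \<Rightarrow> nat \<Rightarrow> bool" where
  "has_subspace_dim n W d \<longleftrightarrow>
     VectorSpace.subspace class_ring W (module_vec TYPE(complex) n) \<and>
     vectorspace.dim class_ring ((module_vec TYPE(complex) n)\<lparr>carrier := W\<rparr>) = d"

text \<open>A complete flag is the list of its \<^term>\<open>n + 1\<close> members, so \<^term>\<open>F ! i\<close> is the
  \<^term>\<open>i\<close>-dimensional one.\<close>

definition Fl :: "nat \<Rightarrow> complex vec set list set" where
  "Fl n = {F. length F = n + 1 \<and>
              (\<forall>i \<le> n. has_subspace_dim n (F ! i) i) \<and>
              (\<forall>i < n. F ! i \<subset> F ! (i + 1)) \<and>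
              F ! n = carrier_vec n}"

text \<open>If \<^term>\<open>a\<close> is a composition of \<^term>\<open>n \<ge> 1\<close>, then \<^term>\<open>n \<in> PS a\<close>, so
  \<^term>\<open>F ! (i + 1)\<close> is only used for \<^term>\<open>i < n\<close>.\<close>

definition Pet :: "nat \<Rightarrow> nat list \<Rightarrow> nat list \<Rightarrow> complex vec set list set" where
  "Pet n l a = {F \<in> Fl n.
     (\<forall>i \<in> PS a. (*\<^sub>v) (nilpotent_jordan l) ` (F ! i) \<subseteq> F ! i) \<and>
     (\<forall>i \<in> {1..n} - PS a. (*\<^sub>v) (nilpotent_jordan l) ` (F ! i) \<subseteq> F ! (i + 1))}"

end

theory Submission
  imports Defs
begin

text \<open>Given a flag in \<open>Pet n l a\<close>, let \<open>b\<close> be the composition whose partial sums are exactly the indices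
  \<open>i\<close> with \<open>N F\<^sub>i \<subseteq> F\<^sub>i\<close>. Then \<open>b\<close> refines \<open>a\<close>, the flag lies in \<open>Pet n l b\<close>, and \<open>N\<close> acts on each block of
  \<open>b\<close> as a single Jordan block. Comparing with the rank of \<open>N\<^sup>k\<close> gives
  \<open>\<Sum> max (b\<^sub>i - k) 0 \<le> \<Sum> max (l\<^sub>i - k) 0\<close> for all \<open>k\<close>, which is dominance of \<open>b\<close> by \<open>l\<close>. Coarsening a
  composition enlarges its variety, so \<open>b\<close> may be replaced by a coarsest element.

  Conversely, for every \<open>b\<close> dominated by \<open>l\<close> there is a flag in \<open>Pet n l b\<close> whose stable indices are
  exactly the partial sums of \<open>b\<close>. It is built one part \<open>k\<close> of \<open>b\<close> at a time: choose a cyclic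
  \<open>N\<close>-submodule of dimension \<open>k\<close> such that the quotient has the most dominant Jordan type. If this
  flag lies in \<open>Pet n l c\<close>, then \<open>b\<close> refines \<open>c\<close>, which for coarsest elements forces \<open>b = c\<close>.\<close>

section \<open>Independence and dimension of subspaces\<close>

context vec_space
begin

text \<open>Independence and span agree in \<open>W\<close> and in the ambient space, and
  independent sets have at most \<open>n\<close> elements, so a maximal independent subset of
  \<open>W\<close> exists and is a basis. This trades the dimension of a restricted structure for a
  concrete set of vectors.\<close>

lemma dim_subspace_basis:
  assumes W: "VectorSpace.subspace class_ring W V"
  obtains B where "finite B" "B \<subseteq> W" "lin_indpt B" "span B = W"
    "card B = vectorspace.dim class_ring (V\<lparr>carrier := W\<rparr>)"
proof -
  have sub: "submodule class_ring W V" and WV: "W \<subseteq> carrier_vec n"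
    using W submodule.subset[of class_ring W V] by auto
  interpret VW: vectorspace class_ring "V\<lparr>carrier := W\<rparr>"
    by (rule subspace_is_vs[OF W])
  have li: "VW.lin_dep X = lin_dep X" if "X \<subseteq> W" for X
    using span_li_not_depend(2)[OF that sub] .
  have sp: "VW.span X = span X" if "X \<subseteq> W" for X
    using span_li_not_depend(1)[OF that sub] .
  have bound: "finite X \<and> card X \<le> n" if "X \<subseteq> W" "VW.lin_indpt X" for X
    using li_le_dim[OF fin_dim, of X] that li WV dim_is_n by auto
  have "VW.lin_indpt {}" by (simp add: VW.lin_dep_def)
  then obtain B where B: "finite B" "maximal B (\<lambda>S. S \<subseteq> W \<and> VW.lin_indpt S)"
    using maximal_exists[of "\<lambda>S. S \<subseteq> W \<and> VW.lin_indpt S" n "{}"] bound by blast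
  have bas: "VW.basis B" using VW.max_li_is_basis B(2) by simp
  then have BW: "B \<subseteq> W" unfolding VW.basis_def by simp
  show ?thesis
  proof (rule that[OF B(1) BW])
    show "lin_indpt B" using bas li[OF BW] unfolding VW.basis_def by simp
    show "span B = W" using bas sp[OF BW] unfolding VW.basis_def by simp
    show "card B = VW.dim" using VW.dim_basis[OF B(1) bas] by simp
  qed
qed

lemma dim_span_indpt:
  assumes B: "finite B" "B \<subseteq> carrier_vec n" "lin_indpt B"
  shows "VectorSpace.subspace class_ring (span B) V"
    and "vectorspace.dim class_ring (V\<lparr>carrier := span B\<rparr>) = card B"
proof -
  show W: "VectorSpace.subspace class_ring (span B) V"
    using span_is_subspace B(2) by simp
  then have sub: "submodule class_ring (span B) V" by simp
  interpret VW: vectorspace class_ring "V\<lparr>carrier := span B\<rparr>"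
    by (rule subspace_is_vs[OF W])
  have BW: "B \<subseteq> span B" using in_own_span B(2) by simp
  have "VW.basis B"
    using span_li_not_depend[OF BW sub] B(3) BW unfolding VW.basis_def by simp
  then show "VW.dim = card B" by (rule VW.dim_basis[OF B(1)])
qed

lemma card_indpt_le:
  assumes "lin_indpt X" "finite X" "X \<subseteq> span U" "finite U" "U \<subseteq> carrier_vec n"
  shows "card X \<le> card U"
  using replacement[of X U] assms by fastforce

lemma indpt_insert:
  assumes "lin_indpt X" "X \<subseteq> carrier_vec n" "x \<in> carrier_vec n" "x \<notin> span X"
  shows "lin_indpt (insert x X)"
proof -
  have "x \<notin> X" using assms(2,4) in_own_span by auto
  then show ?thesis using lin_dep_iff_in_span[of X x] assms by simp
qed

lemma subspace_iff:
  "VectorSpace.subspace class_ring W V \<longleftrightarrow> W \<subseteq> carrier_vec n \<and> 0\<^sub>v n \<in> W \<and>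
     (\<forall>x\<in>W. \<forall>y\<in>W. x + y \<in> W) \<and> (\<forall>c. \<forall>x\<in>W. c \<cdot>\<^sub>v x \<in> W)"
proof
  assume "VectorSpace.subspace class_ring W V"
  then have "submodule class_ring W V" by simp
  then show "W \<subseteq> carrier_vec n \<and> 0\<^sub>v n \<in> W \<and>
     (\<forall>x\<in>W. \<forall>y\<in>W. x + y \<in> W) \<and> (\<forall>c. \<forall>x\<in>W. c \<cdot>\<^sub>v x \<in> W)"
    unfolding submodule_def by auto
next
  assume "W \<subseteq> carrier_vec n \<and> 0\<^sub>v n \<in> W \<and>
     (\<forall>x\<in>W. \<forall>y\<in>W. x + y \<in> W) \<and> (\<forall>c. \<forall>x\<in>W. c \<cdot>\<^sub>v x \<in> W)"
  then show "VectorSpace.subspace class_ring W V"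
    using vec_vs module_axioms by (auto simp: VectorSpace.subspace_def submodule_def vec_module)
qed

lemma span_subset_subspace:
  assumes "VectorSpace.subspace class_ring W V" "X \<subseteq> W"
  shows "span X \<subseteq> W"
  using span_is_subset[of X W] assms by simp

text \<open>Vectors are added in increasing order of index: \<open>G m\<close> contains all earlier
  vectors, hence their span, but not \<open>w m\<close>.\<close>

lemma flag_indpt:
  assumes "finite M" 
    and "\<And>m. m \<in> M \<Longrightarrow> VectorSpace.subspace class_ring (G m) V"
    and "\<And>m m'. m \<in> M \<Longrightarrow> m' \<in> M \<Longrightarrow> m' < m \<Longrightarrow> w m' \<in> G m"
    and "\<And>m. m \<in> M \<Longrightarrow> w m \<in> carrier_vec n - G m"
  shows "lin_indpt (w ` M) \<and> card (w ` M) = card (M :: nat set)"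
  using assms
proof (induction M rule: finite_linorder_max_induct)
  case empty
  then show ?case by (simp add: lin_dep_def)
next
  case (insert m M)
  have IH: "lin_indpt (w ` M) \<and> card (w ` M) = card M"
    using insert.IH insert.prems by simp
  have "w ` M \<subseteq> G m" using insert.prems(2) insert.hyps by auto
  moreover have sub: "VectorSpace.subspace class_ring (G m) V" using insert.prems(1) by simp
  ultimately have "span (w ` M) \<subseteq> G m" by (rule span_subset_subspace[rotated])
  then have new: "w m \<notin> span (w ` M)" using insert.prems(3) by auto
  have car: "w ` M \<subseteq> carrier_vec n" "w m \<in> carrier_vec n" using insert.prems(3) by auto
  have nin: "w m \<notin> w ` M" using new in_own_span[of "w ` M"] car(1) by auto
  have "m \<notin> M" using insert.hyps by auto
  then show ?case using indpt_insert[OF _ car new] IH nin insert.hyps(1) by simp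
qed

text \<open>The preimage of the subspace \<open>W\<close> under \<open>A\<close> is a subspace, so
  it suffices to test a spanning set.\<close>

lemma span_stable:
  assumes A: "A \<in> carrier_mat n n" and X: "X \<subseteq> carrier_vec n"
    and st: "\<And>x. x \<in> X \<Longrightarrow> A *\<^sub>v x \<in> W" and W: "VectorSpace.subspace class_ring W V"
    and x: "x \<in> span X"
  shows "A *\<^sub>v x \<in> W"
proof -
  let ?P = "{x \<in> carrier_vec n. A *\<^sub>v x \<in> W}"
  have "A *\<^sub>v 0\<^sub>v n = 0\<^sub>v n" using A by auto
  then have "VectorSpace.subspace class_ring ?P V"
    using W A unfolding subspace_iff
    by (auto simp: mult_add_distrib_mat_vec[OF A] mult_mat_vec[OF A])
  then show ?thesis using span_subset_subspace[of ?P X] X st x by auto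
qed

end

section \<open>Compositions and dominance\<close>

lemma PS_eq_image: "PS b = (\<lambda>j. sum_list (take j b)) ` {1..length b}"
  unfolding PS_def by auto

lemma PS_Cons: "PS (b # bs) = insert b ((+) b ` PS bs)"
proof -
  have "{1..Suc (length bs)} = insert 1 (Suc ` {1..length bs})"
    by (auto simp: image_iff Bex_def not_less_eq_eq intro: Suc_le_D)
  then have "{1..length (b # bs)} = insert 1 (Suc ` {1..length bs})" by simp
  then show ?thesis
    unfolding PS_eq_image by (simp only: image_insert image_image) simp
qed

lemma PS_Nil: "PS [] = {}"
  unfolding PS_def by auto

lemma PS_subset: "is_composition n b \<Longrightarrow> PS b \<subseteq> {1..n}"
proof (induction b arbitrary: n)
  case (Cons x b)
  then have "PS b \<subseteq> {1..sum_list b}" "0 < x" "n = x + sum_list b"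
    by (auto simp: is_composition_def)
  then show ?case by (auto simp: PS_Cons)
qed (simp add: PS_Nil)

lemma sum_list_in_PS: "b \<noteq> [] \<Longrightarrow> sum_list b \<in> PS b"
  unfolding PS_def by (auto intro!: exI[of _ "length b"] simp: Suc_le_eq)

text \<open>The first part is the least partial sum, since every other one exceeds it by a positive
  partial sum of the tail. Deleting it and shifting leaves the partial sums of the tail.\<close>

lemma PS_inj: "is_composition n b \<Longrightarrow> is_composition m c \<Longrightarrow> PS b = PS c \<Longrightarrow> b = c"
proof (induction b arbitrary: c n m)
  case Nil
  then show ?case by (cases c) (auto simp: PS_Cons PS_Nil)
next
  case (Cons x b)
  from Cons.prems(3) obtain y c' where c: "c = y # c'"
    by (cases c) (auto simp: PS_Cons PS_Nil)
  have b: "is_composition (sum_list b) b" and c': "is_composition (sum_list c') c'"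
    using Cons.prems c by (auto simp: is_composition_def)
  have gt: "z \<in> PS b \<Longrightarrow> 0 < z" "z \<in> PS c' \<Longrightarrow> 0 < z" for z
    using PS_subset[OF b] PS_subset[OF c'] by auto
  have eq: "insert x ((+) x ` PS b) = insert y ((+) y ` PS c')"
    using Cons.prems(3) by (simp add: PS_Cons c)
  have xy: "x = y"
  proof (rule antisym)
    show "x \<le> y" using eq by (metis (no_types, lifting) image_iff insert_iff le_add1 order_refl)
    show "y \<le> x" using eq by (metis (no_types, lifting) image_iff insert_iff le_add1 order_refl)
  qed
  have "(+) x ` PS b = (+) x ` PS c'"
  proof -
    have "x \<notin> (+) x ` PS b" "x \<notin> (+) x ` PS c'" using gt[of 0] by auto
    then show ?thesis using eq unfolding xy by (metis insert_ident)
  qed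
  then have "PS b = PS c'" by (simp add: inj_image_eq_iff)
  then show ?case using Cons.IH[OF b c'] c xy by simp
qed

text \<open>The least element of \<open>T\<close> becomes the first part; the remaining elements,
  shifted down by it, are handled by induction.\<close>

lemma exists_composition_PS:
  assumes "1 \<le> n" "n \<in> T" "T \<subseteq> {1..n}"
  shows "\<exists>b. is_composition n b \<and> PS b = T"
  using assms
proof (induction n arbitrary: T rule: less_induct)
  case (less n)
  have fin: "finite T" using less.prems(3) finite_subset by blast
  define m where "m = Min T"
  have mT: "m \<in> T"
    unfolding m_def using fin less.prems(2) by (intro Min_in) auto
  have mmin: "\<And>t. t \<in> T \<Longrightarrow> m \<le> t"
    unfolding m_def using fin by auto
  have m: "1 \<le> m" "m \<le> n" using mT less.prems(3) by auto
  show ?case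
  proof (cases "m = n")
    case True
    then have "T = {n}" using mmin less.prems by force
    then show ?thesis using less.prems(1)
      by (intro exI[of _ "[n]"]) (auto simp: is_composition_def PS_Cons PS_Nil)
  next
    case False
    let ?T = "(\<lambda>t. t - m) ` (T - {m})"
    have "n - m \<in> ?T" using False less.prems(2) by auto
    moreover have "?T \<subseteq> {1..n - m}"
      using mmin less.prems(3) by (force simp: Suc_le_eq le_less)
    ultimately obtain b where b: "is_composition (n - m) b" "PS b = ?T"
      using less.IH[of "n - m" ?T] m False by (metis (no_types, lifting) Suc_leI diff_less
          le_neq_implies_less less_le_trans One_nat_def zero_less_diff less_eq_Suc_le)
    have "(+) m ` ?T = T - {m}"
      using mmin by (auto simp: image_image image_iff)
    then have "PS (m # b) = T" using b mT by (auto simp: PS_Cons)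
    then show ?thesis using b m
      by (intro exI[of _ "m # b"]) (auto simp: is_composition_def)
  qed
qed

text \<open>The only partial sum in the block of a part \<open>x\<close> is its right end, so the
  windows of length \<open>k\<close> starting at the first \<open>x - k\<close> places of the block
  avoid all partial sums. Windows of the tail are shifted by \<open>x\<close>.\<close>

lemma card_windows_avoiding_PS:
  assumes "is_composition n b"
  shows "(\<Sum>x\<leftarrow>b. x - k) \<le> card {m \<in> {1..n}. {m..<m+k} \<inter> PS b = {}}"
  using assms
proof (induction b arbitrary: n)
  case Nil
  then show ?case by simp
next
  case (Cons x b)
  let ?M = "\<lambda>n b. {m \<in> {1..n}. {m..<m+k} \<inter> PS b = {}}"
  let ?s = "sum_list b"
  have b: "is_composition ?s b" and x: "0 < x" and n: "n = x + ?s"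
    using Cons.prems by (auto simp: is_composition_def)
  have PSb: "PS b \<subseteq> {1..?s}" by (rule PS_subset[OF b])
  have 1: "{1..x - k} \<subseteq> ?M n (x # b)"
    using x n by (auto simp: PS_Cons)
  have 2: "(+) x ` ?M ?s b \<subseteq> ?M n (x # b)"
  proof
    fix y assume "y \<in> (+) x ` ?M ?s b"
    then obtain m where m: "y = x + m" "1 \<le> m" "m \<le> ?s" "{m..<m+k} \<inter> PS b = {}"
      by auto
    have "{y..<y+k} = (+) x ` {m..<m+k}" using m(1) by (simp add: ac_simps)
    then have "{y..<y+k} \<inter> (+) x ` PS b = {}"
      using m(4) by (auto simp flip: image_Int)
    then show "y \<in> ?M n (x # b)" using m n by (auto simp: PS_Cons)
  qed
  have "(\<Sum>x\<leftarrow>x # b. x - k) \<le> card {1..x - k} + card ((+) x ` ?M ?s b)"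
    using Cons.IH[OF b] by (simp add: card_image)
  also have "\<dots> = card ({1..x - k} \<union> (+) x ` ?M ?s b)"
    by (rule card_Un_disjoint[symmetric]) auto
  also have "\<dots> \<le> card (?M n (x # b))"
    using 1 2 by (intro card_mono) auto
  finally show ?case .
qed

section \<open>Dominance in terms of sub-multisets and truncated sums\<close>

text \<open>Exchange argument: remove from \<open>S\<close> the head \<open>d\<close> if it occurs
  there, and otherwise any element, which is at most \<open>d\<close>; what is left fits into the
  tail.\<close>

lemma sum_submset_le_take:
  assumes "sorted_wrt (\<ge>) ds" "S \<subseteq># mset ds"
  shows "sum_mset S \<le> sum_list (take (size S) (ds :: nat list))"
  using assms
proof (induction ds arbitrary: S)
  case (Cons d ds)
  show ?case
  proof (cases "S = {#}")
    case False
    obtain s where s: "s \<in># S" "s \<le> d" "S - {#s#} \<subseteq># mset ds"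
    proof (cases "d \<in># S")
      case True
      then show ?thesis using that[of d] Cons.prems(2)
        by (simp add: subset_eq_diff_conv)
    next
      case F: False
      then have S: "S \<subseteq># mset ds" using Cons.prems(2)
        by (simp add: inter_add_right1 subset_mset.inf.absorb_iff1)
      obtain s where s: "s \<in># S" using False by auto
      then have "s \<in> set ds" using S mset_subset_eqD by fastforce
      then show ?thesis using that[of s] s S Cons.prems(1)
        by (auto intro: subset_mset.order_trans[OF diff_subset_eq_self])
    qed
    have "sum_mset S = s + sum_mset (S - {#s#})" using s(1) by (simp add: sum_mset.remove)
    also have "\<dots> \<le> d + sum_list (take (size (S - {#s#})) ds)"
      using Cons.IH[OF _ s(3)] Cons.prems(1) s(2) by (intro add_mono) auto
    also have "\<dots> = sum_list (take (Suc (size (S - {#s#}))) (d # ds))" by simp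
    also have "Suc (size (S - {#s#})) = size S" using s(1) by (simp add: size_Suc_Diff1)
    finally show ?thesis .
  qed simp
qed simp

text \<open>This form of dominance refers to no sorting of \<open>b\<close>, so the parts of
  \<open>b\<close> can be removed one by one in their given order.\<close>

lemma dominated_by_submset:
  assumes "dominated_by b l" "S \<subseteq># mset b"
  shows "sum_mset S \<le> sum_list (take (size S) l)"
proof (cases "S = {#}")
  case False
  have "sorted_wrt (\<ge>) (rev (sort b))" by (simp add: sorted_wrt_rev)
  then have "sum_mset S \<le> sum_list (take (size S) (rev (sort b)))"
    using assms(2) by (intro sum_submset_le_take) auto
  also have "\<dots> \<le> sum_list (take (size S) l)"
    using assms(1) False by (simp add: dominated_by_def Suc_le_eq nonempty_has_size)
  finally show ?thesis .
qed simp

text \<open>The threshold \<open>k\<close> is \<open>l\<^sub>j\<^sub>+\<^sub>1\<close>: at this value the truncated sum of \<open>l\<close> sees exactly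
  the first \<open>j\<close> parts.\<close>

lemma dominated_by_threshold:
  assumes b: "is_composition n b" and l: "is_partition n l"
    and le: "\<And>k. (\<Sum>x\<leftarrow>b. x - k) \<le> (\<Sum>x\<leftarrow>l. x - k)"
  shows "dominated_by b l"
  unfolding dominated_by_def
proof (intro allI impI)
  fix j :: nat assume "1 \<le> j"
  let ?d = "rev (sort b)"
  have mset_d: "mset ?d = mset b" by simp
  show "sum_list (take j ?d) \<le> sum_list (take j l)"
  proof (cases "j < length l")
    case False
    have "sum_list (take j ?d) \<le> sum_list ?d"
      using append_take_drop_id[of j ?d] by (metis le_add1 sum_list_append)
    also have "\<dots> = sum_list l"
      using b l mset_d by (metis is_composition_def is_partition_def sum_mset_sum_list)
    finally show ?thesis using False by simp
  next
    case True
    define k where "k = l ! j"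
    have hi: "k \<le> x" if x: "x \<in> set (take j l)" for x
    proof -
      obtain i where "i < j" "x = l ! i" using x True by (auto simp: in_set_conv_nth)
      then show ?thesis using l True sorted_wrt_nth_less[of "(\<ge>)" l i j]
        by (auto simp: k_def is_partition_def)
    qed
    have lo: "x \<le> k" if x: "x \<in> set (drop j l)" for x
    proof -
      obtain i where i: "i < length l - j" "x = l ! (j + i)" using x by (auto simp: in_set_conv_nth)
      show ?thesis
        using l i sorted_wrt_nth_less[of "(\<ge>)" l j "j + i"]
        by (cases "i = 0") (auto simp: k_def is_partition_def)
    qed
    \<comment> \<open>With truncated subtraction \<open>x \<le> (x - k) + k\<close>, and this is an
      equality when \<open>k \<le> x\<close>. The inequality is applied to the largest parts of
      \<open>b\<close>, the equality to the first \<open>j\<close> parts of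
      \<open>l\<close>.\<close>
    have cut: "sum_list xs \<le> (\<Sum>x\<leftarrow>xs. x - k) + length xs * k" for xs :: "nat list"
      by (induction xs) auto
    have cut': "sum_list xs = (\<Sum>x\<leftarrow>xs. x - k) + length xs * k" if "\<forall>x\<in>set xs. k \<le> x" for xs
      using that by (induction xs) auto
    have "sum_list (take j ?d) \<le> (\<Sum>x\<leftarrow>take j ?d. x - k) + length (take j ?d) * k"
      by (rule cut)
    also have "\<dots> \<le> (\<Sum>x\<leftarrow>?d. x - k) + j * k"
    proof (rule add_mono)
      show "(\<Sum>x\<leftarrow>take j ?d. x - k) \<le> (\<Sum>x\<leftarrow>?d. x - k)"
        by (metis append_take_drop_id le_add1 map_append sum_list_append)
    qed simp
    also have "(\<Sum>x\<leftarrow>?d. x - k) = (\<Sum>x\<leftarrow>b. x - k)"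
      using mset_d by (metis mset_map sum_mset_sum_list)
    also have "\<dots> \<le> (\<Sum>x\<leftarrow>l. x - k)" by (rule le)
    also have "\<dots> = (\<Sum>x\<leftarrow>take j l. x - k) + (\<Sum>x\<leftarrow>drop j l. x - k)"
      by (metis append_take_drop_id map_append sum_list_append)
    also have "(\<Sum>x\<leftarrow>drop j l. x - k) = 0" using lo by (auto simp: sum_list_eq_0_iff)
    also have "(\<Sum>x\<leftarrow>take j l. x - k) + 0 + j * k = sum_list (take j l)"
      using cut'[of "take j l"] hi True by simp
    finally show ?thesis by simp
  qed
qed

section \<open>Coarsest elements and finiteness\<close>

text \<open>Among the elements of \<open>A\<close> that \<open>b\<close> refines, one with fewest
  partial sums is coarsest: any element of \<open>A\<close> that it refines has the same partial sum
  set, hence equals it by \<open>PS_inj\<close>.\<close>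

lemma refines_coarsest:
  assumes fin: "finite A" and comp: "\<And>b. b \<in> A \<Longrightarrow> is_composition n b" and b: "b \<in> A"
  shows "\<exists>c \<in> coarsest A. refines b c"
proof -
  obtain c where c: "c \<in> A" "refines b c"
    and least: "\<And>d. d \<in> A \<Longrightarrow> refines b d \<Longrightarrow> card (PS c) \<le> card (PS d)"
    using ex_has_least_nat[of "\<lambda>c. c \<in> A \<and> refines b c" b "\<lambda>c. card (PS c)"] b
    by (auto simp: refines_def)
  have "\<not> refines c d" if d: "d \<in> A" "d \<noteq> c" for d
  proof
    assume cd: "refines c d"
    then have "card (PS c) \<le> card (PS d)" using least d(1) c(2) by (auto simp: refines_def)
    moreover have "finite (PS c)" using PS_subset[OF comp[OF c(1)]] finite_subset by blast
    ultimately have "PS d = PS c" using cd card_seteq by (auto simp: refines_def)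
    then show False using PS_inj comp d c(1) by blast
  qed
  then show ?thesis using c by (auto simp: coarsest_def)
qed

lemma finite_compositions: "finite {b. is_composition n b}"
proof (rule finite_subset)
  show "{b. is_composition n b} \<subseteq> {b. set b \<subseteq> {0..n} \<and> length b \<le> n}"
  proof clarify
    fix b assume "is_composition n b"
    then show "set b \<subseteq> {0..n} \<and> length b \<le> n"
    proof (induction b arbitrary: n)
      case (Cons x b)
      then have "set b \<subseteq> {0..sum_list b} \<and> length b \<le> sum_list b" "0 < x" "n = x + sum_list b"
        by (auto simp: is_composition_def)
      then show ?case by auto
    qed simp
  qed
  show "finite {b :: nat list. set b \<subseteq> {0..n} \<and> length b \<le> n}"
    by (rule finite_lists_length_le) simp
qed

section \<open>Removing a strip from the rows of a partition\<close>

text \<open>The row lengths fall from at least \<open>k\<close> to the appended \<open>0\<close>, so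
  they cross \<open>k\<close> between two neighbours. The appended row provides the second neighbour
  when no row of \<open>ps\<close> is short enough.\<close>

lemma sorted_straddle:
  assumes "sorted_wrt (\<ge>) (map fst ps)" "ps \<noteq> []" "k \<le> fst (hd ps)"
  shows "\<exists>xs p q ys. ps @ [(0 :: nat, z)] = xs @ p # q # ys \<and> k \<le> fst p \<and> fst q \<le> k"
  using assms
proof (induction ps)
  case (Cons p ps)
  show ?case
  proof (cases "ps \<noteq> [] \<and> k \<le> fst (hd ps)")
    case True
    then obtain xs p' q ys where "ps @ [(0, z)] = xs @ p' # q # ys" "k \<le> fst p'" "fst q \<le> k"
      using Cons by auto
    then show ?thesis
      by (intro exI[of _ "p # xs"] exI[of _ p'] exI[of _ q] exI[of _ ys]) simp
  next
    case False
    then obtain q ys where "ps @ [(0, z)] = q # ys" "fst q \<le> k"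
      by (cases ps) auto
    then show ?thesis using Cons.prems
      by (intro exI[of _ "[]"] exI[of _ p] exI[of _ q] exI[of _ ys]) simp
  qed
qed simp

text \<open>Replacing the adjacent rows \<open>p \<ge> q\<close> by \<open>p + q - k\<close> is the most dominant way of
  removing a horizontal strip of size \<open>k\<close>.\<close>

lemma dominance_remove_strip:
  fixes xs ys :: "nat list"
  assumes dom: "\<And>S. S \<subseteq># add_mset k B \<Longrightarrow> sum_mset S \<le> sum_list (take (size S) (xs @ p # q # ys))"
    and pq: "k \<le> p" "q \<le> k" and S: "S \<subseteq># B"
  shows "sum_mset S \<le> sum_list (take (size S) (xs @ (p + q - k) # ys))"
proof -
  have 1: "sum_mset S \<le> sum_list (take (size S) (xs @ p # q # ys))"
    using dom[of S] S by (simp add: subset_mset.le_iff_add) (metis union_mset_add_mset_right)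
  have 2: "sum_mset S + k \<le> sum_list (take (Suc (size S)) (xs @ p # q # ys))"
    using dom[of "add_mset k S"] S by (simp add: add.commute)
  \<comment> \<open>If \<open>S\<close> is small, the changed row is not reached and bound
    \<open>1\<close> applies. Otherwise bound \<open>2\<close> sees both \<open>p\<close> and
    \<open>q\<close>, and subtracting \<open>k\<close> turns them into the merged row.\<close>
  show ?thesis
  proof (cases "size S \<le> length xs")
    case True
    then show ?thesis using 1 by simp
  next
    case False
    then obtain m where m: "size S = length xs + Suc m"
      by (metis add_Suc_right less_imp_Suc_add not_le)
    show ?thesis using 2 pq unfolding m by simp
  qed
qed

section \<open>Flags adapted to a nilpotent map\<close>

definition stable :: "'a::semiring_0 mat \<Rightarrow> 'a vec set \<Rightarrow> bool" where
  "stable A W \<longleftrightarrow> (\<forall>x\<in>W. A *\<^sub>v x \<in> W)"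

lemma funpow_stable:
  "\<forall>x\<in>W. A *\<^sub>v x \<in> W \<Longrightarrow> x \<in> W \<Longrightarrow> (((*\<^sub>v) A) ^^ j) x \<in> W"
  by (induction j) auto

context vec_space
begin

lemma funpow_carrier:
  "(A :: 'a mat) \<in> carrier_mat n n \<Longrightarrow> x \<in> carrier_vec n \<Longrightarrow> (((*\<^sub>v) A) ^^ j) x \<in> carrier_vec n"
  by (induction j) auto

lemma funpow_add_vec:
  "(A :: 'a mat) \<in> carrier_mat n n \<Longrightarrow> x \<in> carrier_vec n \<Longrightarrow> y \<in> carrier_vec n \<Longrightarrow>
    (((*\<^sub>v) A) ^^ j) (x + y) = (((*\<^sub>v) A) ^^ j) x + (((*\<^sub>v) A) ^^ j) y"
  by (induction j) (auto simp: mult_add_distrib_mat_vec funpow_carrier)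

lemma funpow_smult_vec:
  "(A :: 'a mat) \<in> carrier_mat n n \<Longrightarrow> x \<in> carrier_vec n \<Longrightarrow>
    (((*\<^sub>v) A) ^^ j) (c \<cdot>\<^sub>v x) = c \<cdot>\<^sub>v (((*\<^sub>v) A) ^^ j) x"
  by (induction j) (auto simp: mult_mat_vec[of A n n] funpow_carrier)

lemma subspace_add_cancel:
  assumes W: "VectorSpace.subspace class_ring W V" and "x + y \<in> W" "x \<in> W" "y \<in> carrier_vec n"
  shows "y \<in> W"
proof -
  have x: "x \<in> carrier_vec n" using assms by (auto simp: subspace_iff)
  have "(x + y) + (- 1) \<cdot>\<^sub>v x \<in> W" using assms by (auto simp: subspace_iff)
  also have "(x + y) + (- 1) \<cdot>\<^sub>v x = y" using x assms(4) by auto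
  finally show ?thesis .
qed

text \<open>Each pair \<open>(r, e)\<close> in \<open>ps\<close> stands for a Jordan chain \<open>e, A e, \<dots>, A\<^sup>r\<^sup>-\<^sup>1 e\<close> of the quotient by
  the span of \<open>us\<close>. Given adjacent chains of lengths \<open>p \<ge> k \<ge> q\<close> with generators \<open>e\<close> and \<open>e'\<close>, the
  vector \<open>v = A\<^sup>p\<^sup>-\<^sup>k e + e'\<close> spans a chain of length \<open>k\<close>, and modulo \<open>v\<close> the two chains merge into the
  single chain of \<open>e\<close>, of length \<open>p + q - k\<close>. Asking only for generation suffices: at the end \<open>n\<close>
  vectors span an \<open>n\<close>-dimensional space, so they form a basis.\<close>

lemma exists_adapted_spanning_list:
  fixes ps :: "(nat \<times> 'a vec) list"
  assumes A: "A \<in> carrier_mat n n"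
    and "sorted_wrt (\<ge>) (map fst ps)"
    and "\<And>z. z \<in> set ps \<Longrightarrow>
      snd z \<in> carrier_vec n \<and> (((*\<^sub>v) A) ^^ fst z) (snd z) \<in> span (set us)"
    and "set us \<subseteq> carrier_vec n"
    and "stable A (span (set us))"
    and "\<And>W. VectorSpace.subspace class_ring W V \<Longrightarrow> stable A W \<Longrightarrow>
      set us \<subseteq> W \<Longrightarrow> snd ` set ps \<subseteq> W \<Longrightarrow> carrier_vec n \<subseteq> W"
    and "is_composition (sum_list (map fst ps)) b"
    and "\<And>S. S \<subseteq># mset b \<Longrightarrow> sum_mset S \<le> sum_list (take (size S) (map fst ps))"
  shows "\<exists>ws. length ws = sum_list b \<and> set ws \<subseteq> carrier_vec n \<and>
    carrier_vec n \<subseteq> span (set (us @ ws)) \<and>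
    (\<forall>i \<in> PS b. stable A (span (set (us @ take i ws)))) \<and>
    (\<forall>i \<in> {1..sum_list b} - PS b. ws ! i = A *\<^sub>v (ws ! (i - 1)))"
  using assms(2-)
proof (induction b arbitrary: ps us)
  case Nil
  have zero: "\<And>z. z \<in> set ps \<Longrightarrow> fst z = 0"
    using Nil.prems(6) by (auto simp: is_composition_def)
  have "VectorSpace.subspace class_ring (span (set us)) V"
    using span_is_subspace Nil.prems(3) by simp
  moreover have "snd ` set ps \<subseteq> span (set us)" using Nil.prems(2) zero by force
  moreover have "set us \<subseteq> span (set us)" using in_own_span Nil.prems(3) by simp
  ultimately have "carrier_vec n \<subseteq> span (set us)" using Nil.prems(4,5) by blast
  then show ?case by (auto simp: PS_Nil)
next
  case (Cons k b)
  let ?f = "(*\<^sub>v) A"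
  let ?U = "span (set us)"
  have k: "0 < k" and sumps: "sum_list (map fst ps) = k + sum_list b"
    and b: "is_composition (sum_list b) b"
    using Cons.prems(6) by (auto simp: is_composition_def)
  \<comment> \<open>Dominance for the single part \<open>k\<close> makes the longest chain at least
    \<open>k\<close> long.\<close>
  have "k \<le> sum_list (take 1 (map fst ps))" using Cons.prems(7)[of "{#k#}"] by simp
  then have hd: "ps \<noteq> []" "k \<le> fst (hd ps)"
    using k by (cases ps; simp)+
  \<comment> \<open>The zero vector is appended as the generator of an empty chain, so that a chain
    of length at most \<open>k\<close> is always available.\<close>
  obtain xs z0 z1 ys where split0: "ps @ [(0, 0\<^sub>v n)] = xs @ z0 # z1 # ys"
      and "k \<le> fst z0" "fst z1 \<le> k"
    using sorted_straddle[OF Cons.prems(1) hd] by blast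
  moreover obtain p e q e' where "z0 = (p, e)" "z1 = (q, e')" by fastforce
  ultimately have split: "ps @ [(0, 0\<^sub>v n)] = xs @ (p, e) # (q, e') # ys" and pq: "k \<le> p" "q \<le> k"
    by auto
  have U: "VectorSpace.subspace class_ring ?U V"
    using span_is_subspace Cons.prems(3) by simp
  have vsU: "set us \<subseteq> ?U" using in_own_span Cons.prems(3) by simp
  have "snd z \<in> carrier_vec n \<and> (?f ^^ fst z) (snd z) \<in> ?U" if "z \<in> set (ps @ [(0, 0\<^sub>v n)])" for z
    using that Cons.prems(2)[of z] U by (auto simp: subspace_iff)
  then have row: "snd z \<in> carrier_vec n \<and> (?f ^^ fst z) (snd z) \<in> ?U"
      if "z \<in> set xs \<union> {(p, e), (q, e')} \<union> set ys" for z
    using that unfolding split by auto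
  have e: "e \<in> carrier_vec n" "(?f ^^ p) e \<in> ?U" "e' \<in> carrier_vec n" "(?f ^^ q) e' \<in> ?U"
    using row[of "(p, e)"] row[of "(q, e')"] by auto
  define v where "v = (?f ^^ (p - k)) e + e'"
  have v: "v \<in> carrier_vec n" using e funpow_carrier[OF A] by (simp add: v_def)
  have pow_v: "(?f ^^ j) v = (?f ^^ (j + (p - k))) e + (?f ^^ j) e'" for j
    unfolding v_def using e funpow_add_vec[OF A] funpow_carrier[OF A] by (simp add: funpow_add)
  define cs where "cs = map (\<lambda>i. (?f ^^ i) v) [0..<k]"
  have cs: "set cs \<subseteq> carrier_vec n" using funpow_carrier[OF A v] by (auto simp: cs_def)
  have stU: "\<forall>x\<in>?U. A *\<^sub>v x \<in> ?U" using Cons.prems(4) by (simp add: stable_def)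
  \<comment> \<open>As \<open>q \<le> k\<close>, also \<open>A^k e'\<close> lies in
    \<open>?U\<close>, and \<open>A^k v\<close> is the sum of \<open>A^p e\<close> and
    \<open>A^k e'\<close>. Hence the chain of \<open>v\<close> closes up modulo \<open>?U\<close>
    after \<open>k\<close> steps.\<close>
  have "(?f ^^ k) e' = (?f ^^ (k - q)) ((?f ^^ q) e')"
    using pq by (simp flip: funpow_add[THEN fun_cong, unfolded o_def])
  then have "(?f ^^ k) e' \<in> ?U" using funpow_stable[OF stU e(4)] by simp
  then have kv: "(?f ^^ k) v \<in> ?U"
    using e(2) pq U unfolding pow_v by (simp add: subspace_iff)
  let ?U' = "span (set (us @ cs))"
  have car': "set (us @ cs) \<subseteq> carrier_vec n" using cs Cons.prems(3) by auto
  have U': "VectorSpace.subspace class_ring ?U' V"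
    using span_is_subspace car' by simp
  have UU': "?U \<subseteq> ?U'" by (rule span_is_monotone) simp
  have own: "set (us @ cs) \<subseteq> ?U'" by (rule in_own_span[OF car'])
  have "A *\<^sub>v x \<in> ?U'" if x: "x \<in> set (us @ cs)" for x
  proof (cases "x \<in> set us")
    case True
    then show ?thesis using vsU stU UU' by blast
  next
    case False
    then obtain i where i: "i < k" "x = (?f ^^ i) v" using x by (auto simp: cs_def)
    have Ax: "A *\<^sub>v x = (?f ^^ Suc i) v" by (simp add: i)
    show ?thesis
    proof (cases "Suc i = k")
      case True
      then show ?thesis using kv UU' Ax by auto
    next
      case F: False
      then have "A *\<^sub>v x \<in> set cs" unfolding Ax cs_def using i(1) by (auto simp del: funpow.simps)
      then show ?thesis using own by auto
    qed
  qed
  then have stU': "stable A ?U'"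
    unfolding stable_def using span_stable[OF A car' _ U'] by blast
  have vcs: "v \<in> set cs" using k by (force simp: cs_def)
  let ?ps = "xs @ (p + q - k, e) # ys"
  have "\<exists>ws. length ws = sum_list b \<and> set ws \<subseteq> carrier_vec n \<and>
    carrier_vec n \<subseteq> span (set ((us @ cs) @ ws)) \<and>
    (\<forall>i \<in> PS b. stable A (span (set ((us @ cs) @ take i ws)))) \<and>
    (\<forall>i \<in> {1..sum_list b} - PS b. ws ! i = A *\<^sub>v (ws ! (i - 1)))"
  proof (rule Cons.IH)
    \<comment> \<open>From \<open>q \<le> k\<close> and \<open>k \<le> p\<close> follows
      \<open>q \<le> p + q - k\<close> and \<open>p + q - k \<le> p\<close>, so the merged row keeps
      its place in the order.\<close>
    have "sorted_wrt (\<ge>) (map fst (ps @ [(0, 0\<^sub>v n)]))"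
      using Cons.prems(1) by (simp add: sorted_wrt_append)
    then show "sorted_wrt (\<ge>) (map fst ?ps)"
      using pq unfolding split by (fastforce simp: sorted_wrt_append)
    show "snd z \<in> carrier_vec n \<and> (?f ^^ fst z) (snd z) \<in> ?U'" if z: "z \<in> set ?ps" for z
    proof (cases "z \<in> set xs \<union> set ys")
      case True
      then show ?thesis using row[of z] UU' by auto
    next
      case False
      then have z: "z = (p + q - k, e)" using z by auto
      \<comment> \<open>Since \<open>A^q e'\<close> lies in \<open>?U\<close>, the formula for
        \<open>A^q v\<close> shows that \<open>A^(q + (p - k)) e\<close> vanishes modulo
        \<open>?U'\<close>.\<close>
      have "(?f ^^ q) v \<in> ?U'"
        using funpow_stable[of ?U' A v] stU' own vcs by (auto simp: stable_def)
      then have "(?f ^^ q) e' + (?f ^^ (q + (p - k))) e \<in> ?U'"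
        unfolding pow_v using e funpow_carrier[OF A] by (metis comm_add_vec)
      then have "(?f ^^ (q + (p - k))) e \<in> ?U'"
      proof (rule subspace_add_cancel[OF U'])
        show "(?f ^^ q) e' \<in> ?U'" using e(4) UU' by blast
        show "(?f ^^ (q + (p - k))) e \<in> carrier_vec n" by (rule funpow_carrier[OF A e(1)])
      qed
      then show ?thesis using e z pq by (simp add: add.commute)
    qed
    show "set (us @ cs) \<subseteq> carrier_vec n" by (rule car')
    show "stable A ?U'" by (rule stU')
    show "carrier_vec n \<subseteq> W"
      if W: "VectorSpace.subspace class_ring W V" and st: "stable A W"
        and vsW: "set (us @ cs) \<subseteq> W" and psW: "snd ` set ?ps \<subseteq> W" for W
    proof (rule Cons.prems(5)[OF W st])
      show "set us \<subseteq> W" using vsW by simp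
      \<comment> \<open>The discarded generator is recovered as \<open>e' = v - A^(p - k) e\<close>,
        so the new data still generate everything.\<close>
      have "(?f ^^ (p - k)) e \<in> W"
        using funpow_stable[of W A e] st psW by (auto simp: stable_def)
      moreover have "v \<in> W" using vsW vcs by auto
      ultimately have "e' \<in> W" unfolding v_def using subspace_add_cancel[OF W] e by blast
      then have "snd ` set (ps @ [(0, 0\<^sub>v n)]) \<subseteq> W" using psW unfolding split by auto
      then show "snd ` set ps \<subseteq> W" by auto
    qed
    have "sum_list (map fst (ps @ [(0, 0\<^sub>v n)])) = k + sum_list b" using sumps by simp
    then have "sum_list (map fst ?ps) = sum_list b" unfolding split using pq by simp
    then show "is_composition (sum_list (map fst ?ps)) b" using b by simp
    show "sum_mset S \<le> sum_list (take (size S) (map fst ?ps))" if S: "S \<subseteq># mset b" for S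
    proof -
      have "sum_mset S \<le> sum_list (take (size S) (map fst xs @ (p + q - k) # map fst ys))"
      proof (rule dominance_remove_strip[OF _ pq S])
        fix S assume "S \<subseteq># add_mset k (mset b)"
        then have "sum_mset S \<le> sum_list (take (size S) (map fst ps))"
          using Cons.prems(7) by simp
        also have "\<dots> \<le> sum_list (take (size S) (map fst (ps @ [(0, 0\<^sub>v n)])))" by simp
        finally show "sum_mset S \<le> sum_list (take (size S) (map fst xs @ p # q # map fst ys))"
          unfolding split by simp
      qed
      then show ?thesis by simp
    qed
  qed
  then obtain ws where ws: "length ws = sum_list b" "set ws \<subseteq> carrier_vec n"
    "carrier_vec n \<subseteq> span (set (us @ cs @ ws))"
    "\<And>i. i \<in> PS b \<Longrightarrow> stable A (span (set (us @ cs @ take i ws)))"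
    "\<And>i. i \<in> {1..sum_list b} - PS b \<Longrightarrow> ws ! i = A *\<^sub>v (ws ! (i - 1))"
    by auto
  have len: "length cs = k" by (simp add: cs_def)
  show ?case
  proof (intro exI[of _ "cs @ ws"] conjI ballI)
    show "length (cs @ ws) = sum_list (k # b)" using ws(1) len by simp
    show "set (cs @ ws) \<subseteq> carrier_vec n" using cs ws(2) by simp
    show "carrier_vec n \<subseteq> span (set (us @ cs @ ws))" by (rule ws(3))
    show "stable A (span (set (us @ take i (cs @ ws))))" if "i \<in> PS (k # b)" for i
      using that stU' ws(4) len by (auto simp: PS_Cons)
    show "(cs @ ws) ! i = A *\<^sub>v ((cs @ ws) ! (i - 1))" if i: "i \<in> {1..sum_list (k # b)} - PS (k # b)" for i
    proof (cases "i < k")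
      case True
      then have "(cs @ ws) ! i = (?f ^^ Suc (i - 1)) v" "(cs @ ws) ! (i - 1) = (?f ^^ (i - 1)) v"
        using i by (auto simp: cs_def nth_append)
      then show ?thesis by simp
    next
      case False
      define j where "j = i - k"
      have ij: "i = k + j" using False by (simp add: j_def)
      \<comment> \<open>\<open>k\<close> itself is a partial sum, so \<open>i\<close> is not the
        first index of the tail and \<open>ws ! (j - 1)\<close> belongs to the tail as well.\<close>
      have "j \<noteq> 0" "j \<notin> PS b" "j \<le> sum_list b"
        using i unfolding ij by (auto simp: PS_Cons)
      then have "ws ! j = A *\<^sub>v (ws ! (j - 1))" using ws(5)[of j] by simp
      moreover have "\<not> k + j - 1 < k" "k + j - 1 - k = j - 1" using \<open>j \<noteq> 0\<close> by auto
      ultimately show ?thesis using len unfolding ij by (simp add: nth_append)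
    qed
  qed
qed

section \<open>The rank bound for a flag\<close>

text \<open>A hyperplane \<open>W\<close> of \<open>W'\<close> and one vector outside it span
  \<open>W'\<close>: a vector of \<open>W'\<close> outside their span would give
  \<open>d + 2\<close> independent vectors in a space spanned by \<open>d + 1\<close>.\<close>

lemma subspace_dim_Suc:
  assumes W: "VectorSpace.subspace class_ring W V"
      "vectorspace.dim class_ring (V\<lparr>carrier := W\<rparr>) = d"
    and W': "VectorSpace.subspace class_ring W' V"
      "vectorspace.dim class_ring (V\<lparr>carrier := W'\<rparr>) = Suc d"
    and WW': "W \<subseteq> W'" and x: "x \<in> W' - W"
    and P: "VectorSpace.subspace class_ring P V" "W \<subseteq> P" "x \<in> P"
  shows "W' \<subseteq> P"
proof
  fix y assume y: "y \<in> W'"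
  obtain B where B: "finite B" "B \<subseteq> W" "lin_indpt B" "span B = W" "card B = d"
    using dim_subspace_basis[OF W(1)] W(2) by metis
  obtain B' where B': "finite B'" "B' \<subseteq> W'" "span B' = W'" "card B' = Suc d"
    using dim_subspace_basis[OF W'(1)] W'(2) by metis
  have car: "W' \<subseteq> carrier_vec n" using W'(1) by (simp add: subspace_iff)
  have xB: "lin_indpt (insert x B)" using indpt_insert[of B x] B x car WW' by auto
  have nin: "x \<notin> B" using x B(2) by auto
  have "y \<in> span (insert x B)"
  proof (rule ccontr)
    assume n: "y \<notin> span (insert x B)"
    have sub: "insert x B \<subseteq> carrier_vec n" using x B(2) WW' car by auto
    have "lin_indpt (insert y (insert x B))"
      using indpt_insert[OF xB sub _ n] y car by auto
    moreover have "y \<notin> insert x B" using n in_own_span[of "insert x B"] sub by auto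
    then have "card (insert y (insert x B)) = Suc (Suc d)" using B nin by simp
    moreover have "insert y (insert x B) \<subseteq> span B'" using B B' WW' x y by auto
    moreover have "B' \<subseteq> carrier_vec n" using B' car by auto
    ultimately show False using card_indpt_le[of "insert y (insert x B)" B'] B(1) B'(1,4) by simp
  qed
  moreover have "span (insert x B) \<subseteq> P"
    using B(2) P by (intro span_subset_subspace) auto
  ultimately show "y \<in> P" by blast
qed

text \<open>The vectors \<open>A\<^sup>k e\<^sub>m\<close> with \<open>e\<^sub>m \<in> G m - G (m - 1)\<close> and no stable member of the flag among
  \<open>G m, \<dots>, G (m + k - 1)\<close> lie in distinct layers of the flag, so they are independent in the image
  of \<open>A\<^sup>k\<close>, which is spanned by the \<open>A\<^sup>s g\<close> with \<open>k \<le> s\<close>.\<close>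

lemma flag_truncated_sum_le:
  fixes ps :: "(nat \<times> 'a vec) list"
  assumes A: "A \<in> carrier_mat n n"
    and G: "\<And>i. i \<le> n \<Longrightarrow> VectorSpace.subspace class_ring (G i) V"
      "\<And>i. i \<le> n \<Longrightarrow> vectorspace.dim class_ring (V\<lparr>carrier := G i\<rparr>) = i"
      "\<And>i. i < n \<Longrightarrow> G i \<subset> G (Suc i)"
    and b: "is_composition n b"
      "\<And>i. i \<in> PS b \<longleftrightarrow> i \<in> {1..n} \<and> (*\<^sub>v) A ` G i \<subseteq> G i"
    and step: "\<And>i. i \<in> {1..n} - PS b \<Longrightarrow> (*\<^sub>v) A ` G i \<subseteq> G (Suc i)"
    and gen: "\<And>z. z \<in> set ps \<Longrightarrow> snd z \<in> carrier_vec n \<and> (((*\<^sub>v) A) ^^ fst z) (snd z) = 0\<^sub>v n"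
      "\<And>W. VectorSpace.subspace class_ring W V \<Longrightarrow> (\<forall>x\<in>W. A *\<^sub>v x \<in> W) \<Longrightarrow>
        snd ` set ps \<subseteq> W \<Longrightarrow> carrier_vec n \<subseteq> W"
  shows "(\<Sum>x\<leftarrow>b. x - k) \<le> (\<Sum>z\<leftarrow>ps. fst z - k)"
proof -
  let ?f = "(*\<^sub>v) A"
  have mono: "G i \<subseteq> G j" if "i \<le> j" "j \<le> n" for i j
    using that
  proof (induction rule: dec_induct)
    case (step m)
    then show ?case using G(3)[of m] by auto
  qed simp
  have car: "G i \<subseteq> carrier_vec n" if "i \<le> n" for i
    using G(1)[OF that] by (simp add: subspace_iff)
  have G0: "G 0 = {0\<^sub>v n}"
    using dim_subspace_basis[OF G(1)[of 0]] G(2)[of 0] span_empty by (metis card_0_eq le0)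
  have jump: "A *\<^sub>v x \<in> G (Suc m) - G m" if m: "m \<in> {1..n} - PS b" and x: "x \<in> G m - G (m - 1)" for m x
  proof -
    have m1: "m - 1 \<le> n" "Suc (m - 1) = m" "m - 1 < n" "m \<le> n" using m by auto
    have "A *\<^sub>v x \<in> G (Suc m)" using step[OF m] x by auto
    moreover have "A *\<^sub>v x \<notin> G m"
    proof
      assume xm: "A *\<^sub>v x \<in> G m"
      \<comment> \<open>If \<open>A x\<close> stayed in \<open>G m\<close>, this preimage would
        contain \<open>G (m - 1)\<close> and \<open>x\<close>, hence all of \<open>G m\<close> by
        \<open>subspace_dim_Suc\<close>; then \<open>G m\<close> would be stable although
        \<open>m\<close> is not in \<open>PS b\<close>.\<close>
      let ?P = "{y \<in> carrier_vec n. A *\<^sub>v y \<in> G m}"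
      have zero: "A *\<^sub>v 0\<^sub>v n = 0\<^sub>v n" using A by auto
      have "VectorSpace.subspace class_ring ?P V"
        using G(1)[OF m1(4)] A zero unfolding subspace_iff
        by (auto simp: mult_add_distrib_mat_vec[OF A] mult_mat_vec[OF A])
      moreover have "G (m - 1) \<subseteq> ?P"
      proof
        fix y assume y: "y \<in> G (m - 1)"
        have "A *\<^sub>v y \<in> G m"
        \<comment> \<open>Index \<open>0\<close> is subject to none of the conditions on the flag;
          there \<open>G 0\<close> is zero.\<close>
        proof (cases "m - 1 = 0")
          case True
          then show ?thesis using y G0 zero G(1)[OF m1(4)] by (simp add: subspace_iff)
        next
          case False
          then show ?thesis
            using y b(2)[of "m - 1"] step[of "m - 1"] mono[of "m - 1" m] m1
            by (cases "m - 1 \<in> PS b") (simp_all add: image_subset_iff subset_iff)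
        qed
        then show "y \<in> ?P" using y car[OF m1(1)] by auto
      qed
      moreover have "x \<in> ?P" using x xm car[OF m1(4)] by auto
      ultimately have "G m \<subseteq> ?P"
        using subspace_dim_Suc[OF G(1,2)[OF m1(1)] G(1)[OF m1(4)], of x ?P] G(2)[OF m1(4)]
          G(3)[OF m1(3)] m1(2) x by auto
      then have "m \<in> PS b" using b(2)[of m] m by auto
      then show False using m by simp
    qed
    ultimately show ?thesis by simp
  qed
  have nPS: "n \<in> PS b" if "1 \<le> n"
    using that b(1) sum_list_in_PS[of b] by (cases b) (auto simp: is_composition_def)
  have jumps: "m + j \<le> n \<and> (?f ^^ j) x \<in> G (m + j) - G (m + j - 1)"
    if m: "m \<in> {1..n}" and w: "{m..<m+j} \<inter> PS b = {}" and x: "x \<in> G m - G (m - 1)" for m j x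
    using w
  proof (induction j)
    case 0
    then show ?case using m x by simp
  next
    case (Suc j)
    have IH: "m + j \<le> n \<and> (?f ^^ j) x \<in> G (m + j) - G (m + j - 1)"
    proof (rule Suc.IH)
      have "{m..<m+j} \<subseteq> {m..<m + Suc j}" by auto
      then show "{m..<m+j} \<inter> PS b = {}" using Suc.prems by blast
    qed
    have "m + j \<in> {m..<m + Suc j}" by simp
    then have nin: "m + j \<notin> PS b" using Suc.prems by blast
    \<comment> \<open>The last index \<open>n\<close> is a partial sum, so an index outside
      \<open>PS b\<close> lies below it and the flag has a next member.\<close>
    then have "m + j \<noteq> n" using nPS m by auto
    then show ?case using jump[of "m + j"] IH nin m by auto
  qed
  have "\<exists>x. x \<in> G m - G (m - 1)" if "m \<in> {1..n}" for m
  proof -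
    have "m - 1 < n" "Suc (m - 1) = m" using that by auto
    then show ?thesis using G(3)[of "m - 1"] by auto
  qed
  then obtain e where e: "\<And>m. m \<in> {1..n} \<Longrightarrow> e m \<in> G m - G (m - 1)" by metis
  let ?M = "{m \<in> {1..n}. {m..<m+k} \<inter> PS b = {}}"
  let ?w = "\<lambda>m. (?f ^^ k) (e m)"
  have w: "m + k \<le> n \<and> ?w m \<in> G (m + k) - G (m + k - 1)" if "m \<in> ?M" for m
    using jumps[of m k "e m"] e that by auto
  have indpt: "lin_indpt (?w ` ?M) \<and> card (?w ` ?M) = card ?M"
  \<comment> \<open>Each application of \<open>A\<close> climbs one layer, so \<open>?w m\<close>
    first appears in \<open>G (m + k)\<close>, while \<open>G (m + k - 1)\<close> contains all
    images of smaller index.\<close>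
  proof (rule flag_indpt[where G = "\<lambda>m. G (m + k - 1)"])
    show "VectorSpace.subspace class_ring (G (m + k - 1)) V" if "m \<in> ?M" for m
      using G(1)[of "m + k - 1"] w[OF that] by auto
    show "?w m' \<in> G (m + k - 1)" if "m \<in> ?M" "m' \<in> ?M" "m' < m" for m m'
    proof -
      have "m' + k \<le> m + k - 1" "m + k - 1 \<le> n" using w[OF that(1)] that(3) by auto
      then show ?thesis using mono w[OF that(2)] by blast
    qed
    show "?w m \<in> carrier_vec n - G (m + k - 1)" if "m \<in> ?M" for m
      using w[OF that] car[of "m + k"] by auto
  qed simp
  \<comment> \<open>A chain of length \<open>fst z\<close> has \<open>fst z - k\<close> vectors of
    exponent at least \<open>k\<close>, so the length of this list is the right-hand side of the
    bound.\<close>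
  let ?us = "concat (map (\<lambda>z. map (\<lambda>s. (?f ^^ s) (snd z)) [k..<fst z]) ps)"
  have us: "set ?us \<subseteq> carrier_vec n" using funpow_carrier[OF A] gen(1) by auto
  have U: "VectorSpace.subspace class_ring (span (set ?us)) V" using span_is_subspace us by simp
  have pow0: "(?f ^^ j) (0\<^sub>v n) = 0\<^sub>v n" for j
    using A by (induction j) auto
  have high: "(?f ^^ s) (snd z) \<in> span (set ?us)" if z: "z \<in> set ps" and s: "k \<le> s" for z s
  proof (cases "s < fst z")
    case True
    then have "(?f ^^ s) (snd z) \<in> set ?us" using z s by (force intro!: bexI[of _ z])
    then show ?thesis using in_own_span[OF us] by blast
  next
    case False
    then have "(?f ^^ s) (snd z) = (?f ^^ (s - fst z)) ((?f ^^ fst z) (snd z))"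
      by (simp flip: funpow_add[THEN fun_cong, unfolded o_def])
    then show ?thesis using gen(1)[OF z] pow0 U by (simp add: subspace_iff)
  qed
  have stU: "\<forall>x\<in>span (set ?us). A *\<^sub>v x \<in> span (set ?us)"
  proof
    fix x assume x: "x \<in> span (set ?us)"
    show "A *\<^sub>v x \<in> span (set ?us)"
    proof (rule span_stable[OF A us _ U x])
      fix y assume "y \<in> set ?us"
      then obtain z s where z: "z \<in> set ps" "k \<le> s" "y = (?f ^^ s) (snd z)" by auto
      then show "A *\<^sub>v y \<in> span (set ?us)" using high[OF z(1), of "Suc s"] by simp
    qed
  qed
  \<comment> \<open>This preimage is a stable subspace containing the generators, so it is
    everything: the image of \<open>A^k\<close> lies in the span of \<open>?us\<close>.\<close>
  let ?P = "{x \<in> carrier_vec n. (?f ^^ k) x \<in> span (set ?us)}"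
  have "carrier_vec n \<subseteq> ?P"
  proof (rule gen(2))
    show "VectorSpace.subspace class_ring ?P V"
      using U pow0 unfolding subspace_iff
      by (auto simp: funpow_add_vec[OF A] funpow_smult_vec[OF A])
    show "\<forall>x\<in>?P. A *\<^sub>v x \<in> ?P"
    proof
      fix x assume "x \<in> ?P"
      moreover have "(?f ^^ k) (A *\<^sub>v x) = A *\<^sub>v (?f ^^ k) x"
        by (rule funpow_swap1[symmetric])
      ultimately show "A *\<^sub>v x \<in> ?P" using stU A by simp
    qed
    show "snd ` set ps \<subseteq> ?P" using gen(1) high by auto
  qed
  moreover have "e m \<in> carrier_vec n" if "m \<in> ?M" for m
    using e[of m] car[of m] that by auto
  ultimately have sub: "?w ` ?M \<subseteq> span (set ?us)" by blast
  have "(\<Sum>x\<leftarrow>b. x - k) \<le> card ?M" by (rule card_windows_avoiding_PS[OF b(1)])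
  also have "\<dots> \<le> card (set ?us)"
    using card_indpt_le[of "?w ` ?M" "set ?us"] indpt sub us by auto
  also have "\<dots> \<le> length ?us" by (rule card_length)
  also have "\<dots> = (\<Sum>z\<leftarrow>ps. fst z - k)" by (simp add: length_concat comp_def)
  finally show ?thesis .
qed

end

section \<open>Jordan matrices\<close>

lemma funpow_four_block_append:
  fixes A :: "'a::semiring_1 mat"
  assumes A: "A \<in> carrier_mat k k" and B: "B \<in> carrier_mat m m"
    and x: "x \<in> carrier_vec k" and y: "y \<in> carrier_vec m"
  shows "(((*\<^sub>v) (four_block_mat A (0\<^sub>m k m) (0\<^sub>m m k) B)) ^^ j) (x @\<^sub>v y) =
    (((*\<^sub>v) A) ^^ j) x @\<^sub>v (((*\<^sub>v) B) ^^ j) y"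
proof (induction j)
  case (Suc j)
  have "(((*\<^sub>v) A) ^^ j) x \<in> carrier_vec k" using A x by (induction j) auto
  moreover have "(((*\<^sub>v) B) ^^ j) y \<in> carrier_vec m" using B y by (induction j) auto
  ultimately show ?case using Suc by (simp add: mult_mat_vec_split[OF A B])
qed simp

lemma jordan_block_mult_unit_vec:
  assumes "i < k"
  shows "jordan_block k (0 :: 'a::comm_ring_1) *\<^sub>v unit_vec k i = (if i = 0 then 0\<^sub>v k else unit_vec k (i - 1))"
proof (rule eq_vecI)
  fix r assume r: "r < dim_vec (if i = 0 then 0\<^sub>v k else unit_vec k (i - 1) :: 'a vec)"
  then have r: "r < k" by (auto split: if_splits)
  have "(jordan_block k (0 :: 'a) *\<^sub>v unit_vec k i) $ r = jordan_block k 0 $$ (r, i)"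
    using assms r by simp
  then show "(jordan_block k (0 :: 'a) *\<^sub>v unit_vec k i) $ r = (if i = 0 then 0\<^sub>v k else unit_vec k (i - 1)) $ r"
    using assms r by auto
qed simp

lemma jordan_block_funpow_unit_vec:
  assumes "i < k"
  shows "(((*\<^sub>v) (jordan_block k (0 :: 'a::comm_ring_1))) ^^ j) (unit_vec k i) =
    (if j \<le> i then unit_vec k (i - j) else 0\<^sub>v k)"
proof (induction j)
  case (Suc j)
  have "jordan_block k (0 :: 'a) *\<^sub>v 0\<^sub>v k = 0\<^sub>v k" by (rule eq_vecI) auto
  then show ?case using Suc assms
    by (auto simp: jordan_block_mult_unit_vec)
qed simp

lemma nilpotent_jordan_Cons:
  "nilpotent_jordan (k # l) = four_block_mat (jordan_block k 0)
     (0\<^sub>m k (sum_list l)) (0\<^sub>m (sum_list l) k) (nilpotent_jordan l)"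
  by (simp add: nilpotent_jordan_def jordan_matrix_Cons comp_def)

lemma nilpotent_jordan_carrier: "nilpotent_jordan l \<in> carrier_mat (sum_list l) (sum_list l)"
  using jordan_matrix_carrier[of "map (\<lambda>k. (k, 0 :: complex)) l"]
  by (simp add: nilpotent_jordan_def comp_def)

text \<open>Each block contributes one chain, killed after as many steps as the block is long, and
  together the chains generate the space. The flag arguments above take the Jordan type only in this
  coordinate-free form.\<close>

lemma nilpotent_jordan_generators:
  "\<exists>ps. map fst ps = l \<and>
    (\<forall>z \<in> set ps. snd z \<in> carrier_vec (sum_list l) \<and>
      (((*\<^sub>v) (nilpotent_jordan l)) ^^ fst z) (snd z) = 0\<^sub>v (sum_list l)) \<and>
    (\<forall>W. VectorSpace.subspace class_ring W (module_vec TYPE(complex) (sum_list l)) \<longrightarrow>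
      (\<forall>x \<in> W. nilpotent_jordan l *\<^sub>v x \<in> W) \<longrightarrow> snd ` set ps \<subseteq> W \<longrightarrow>
      carrier_vec (sum_list l) \<subseteq> W)"
proof (induction l)
  case Nil
  have "carrier_vec 0 \<subseteq> W" if "VectorSpace.subspace class_ring W (module_vec TYPE(complex) 0)" for W
  proof
    fix x :: "complex vec" assume "x \<in> carrier_vec 0"
    then have "x = 0\<^sub>v 0" by (intro eq_vecI) auto
    then show "x \<in> W" using that[unfolded vec_space.subspace_iff] by blast
  qed
  then show ?case by (intro exI[of _ "[]"]) simp
next
  case (Cons k l)
  let ?m = "sum_list l"
  let ?J = "jordan_block k (0 :: complex)"
  let ?N = "nilpotent_jordan l"
  let ?K = "nilpotent_jordan (k # l)"
  have J: "?J \<in> carrier_mat k k" by (simp add: jordan_block_def)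
  have N: "?N \<in> carrier_mat ?m ?m" by (rule nilpotent_jordan_carrier)
  have J0: "?J *\<^sub>v 0\<^sub>v k = 0\<^sub>v k" using J by auto
  have N0: "?N *\<^sub>v 0\<^sub>v ?m = 0\<^sub>v ?m" using N by auto
  have J0': "(((*\<^sub>v) ?J) ^^ j) (0\<^sub>v k) = 0\<^sub>v k" for j using J0 by (induction j) auto
  have N0': "(((*\<^sub>v) ?N) ^^ j) (0\<^sub>v ?m) = 0\<^sub>v ?m" for j using N0 by (induction j) auto
  have K: "?K *\<^sub>v (x @\<^sub>v y) = ?J *\<^sub>v x @\<^sub>v ?N *\<^sub>v y" if "x \<in> carrier_vec k" "y \<in> carrier_vec ?m" for x y
    unfolding nilpotent_jordan_Cons by (rule mult_mat_vec_split[OF J N that])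
  have Kpow: "(((*\<^sub>v) ?K) ^^ j) (x @\<^sub>v y) = (((*\<^sub>v) ?J) ^^ j) x @\<^sub>v (((*\<^sub>v) ?N) ^^ j) y"
    if "x \<in> carrier_vec k" "y \<in> carrier_vec ?m" for x y j
    unfolding nilpotent_jordan_Cons by (rule funpow_four_block_append[OF J N that])
  have zero: "0\<^sub>v (k + ?m) = (0\<^sub>v k @\<^sub>v 0\<^sub>v ?m :: complex vec)" by (intro eq_vecI) auto
  have smult: "c \<cdot>\<^sub>v (x @\<^sub>v y) = (c \<cdot>\<^sub>v x @\<^sub>v c \<cdot>\<^sub>v y)"
    if "x \<in> carrier_vec k" "y \<in> carrier_vec ?m" for c :: complex and x y
    using that by (intro eq_vecI) auto
  have smult0: "c \<cdot>\<^sub>v 0\<^sub>v r = 0\<^sub>v r" for c :: complex and r by (intro eq_vecI) auto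
  note add = append_vec_add[where n = k and m = ?m]
  obtain ps where ps: "map fst ps = l"
    "\<And>z. z \<in> set ps \<Longrightarrow> snd z \<in> carrier_vec ?m \<and> (((*\<^sub>v) ?N) ^^ fst z) (snd z) = 0\<^sub>v ?m"
    "\<And>W. VectorSpace.subspace class_ring W (module_vec TYPE(complex) ?m) \<Longrightarrow>
      (\<forall>x \<in> W. ?N *\<^sub>v x \<in> W) \<Longrightarrow> snd ` set ps \<subseteq> W \<Longrightarrow> carrier_vec ?m \<subseteq> W"
    using Cons by blast
  \<comment> \<open>The ones of a Jordan block lie above the diagonal, so it lowers the index of a
    unit vector and the last one generates. For \<open>k = 0\<close> this is the empty
    vector.\<close>
  define e where "e = (unit_vec k (k - 1) :: complex vec)"
  have e: "e \<in> carrier_vec k" by (simp add: e_def)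
  have ke: "(((*\<^sub>v) ?J) ^^ k) e = 0\<^sub>v k"
  proof (cases "k = 0")
    case True
    then show ?thesis using e by auto
  next
    case False
    then show ?thesis unfolding e_def by (simp add: jordan_block_funpow_unit_vec)
  qed
  let ?ps = "(k, e @\<^sub>v 0\<^sub>v ?m) # map (\<lambda>z. (fst z, 0\<^sub>v k @\<^sub>v snd z)) ps"
  show ?case
  proof (intro exI[of _ ?ps] conjI ballI allI impI)
    show "map fst ?ps = k # l" using ps(1) by (simp add: comp_def)
  next
    fix z assume "z \<in> set ?ps"
    then consider "z = (k, e @\<^sub>v 0\<^sub>v ?m)" | y where "y \<in> set ps" "z = (fst y, 0\<^sub>v k @\<^sub>v snd y)"
      by auto
    note zcases = this
    show "snd z \<in> carrier_vec (sum_list (k # l))"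
      using zcases e ps(2) by cases auto
    show "(((*\<^sub>v) ?K) ^^ fst z) (snd z) = 0\<^sub>v (sum_list (k # l))"
      using zcases e ps(2) by cases (auto simp: Kpow zero ke J0' N0')
  next
    fix W assume W: "VectorSpace.subspace class_ring W (module_vec TYPE(complex) (sum_list (k # l)))"
      and st: "\<forall>x \<in> W. ?K *\<^sub>v x \<in> W" and gW: "snd ` set ?ps \<subseteq> W"
    have W': "W \<subseteq> carrier_vec (k + ?m)" "0\<^sub>v k @\<^sub>v 0\<^sub>v ?m \<in> W"
      "\<And>x y. x \<in> W \<Longrightarrow> y \<in> W \<Longrightarrow> x + y \<in> W" "\<And>c x. x \<in> W \<Longrightarrow> c \<cdot>\<^sub>v x \<in> W"
      using W[unfolded vec_space.subspace_iff] by (auto simp flip: zero)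
    \<comment> \<open>The slices of \<open>W\<close> along the two summands are stable subspaces
      containing the respective generators; each is therefore the whole summand, and their sum fills
      the space.\<close>
    let ?X = "{x \<in> carrier_vec k. x @\<^sub>v 0\<^sub>v ?m \<in> W}"
    let ?Y = "{y \<in> carrier_vec ?m. 0\<^sub>v k @\<^sub>v y \<in> W}"
    have X: "VectorSpace.subspace class_ring ?X (module_vec TYPE(complex) k)"
      unfolding vec_space.subspace_iff
    proof (intro conjI ballI allI)
      fix x y assume xy: "x \<in> ?X" "y \<in> ?X"
      then have "(x @\<^sub>v 0\<^sub>v ?m) + (y @\<^sub>v 0\<^sub>v ?m) \<in> W" using W'(3) by auto
      also have "(x @\<^sub>v 0\<^sub>v ?m) + (y @\<^sub>v 0\<^sub>v ?m) = (x + y) @\<^sub>v (0\<^sub>v ?m + 0\<^sub>v ?m)"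
        using xy by (intro add) auto
      finally show "x + y \<in> ?X" using xy by auto
    next
      fix c x assume x: "x \<in> ?X"
      then have "c \<cdot>\<^sub>v (x @\<^sub>v 0\<^sub>v ?m) \<in> W" using W'(4) by auto
      then show "c \<cdot>\<^sub>v x \<in> ?X" using x by (auto simp: smult smult0)
    qed (use W'(2) in auto)
    have Y: "VectorSpace.subspace class_ring ?Y (module_vec TYPE(complex) ?m)"
      unfolding vec_space.subspace_iff
    proof (intro conjI ballI allI)
      fix x y assume xy: "x \<in> ?Y" "y \<in> ?Y"
      then have "(0\<^sub>v k @\<^sub>v x) + (0\<^sub>v k @\<^sub>v y) \<in> W" using W'(3) by auto
      also have "(0\<^sub>v k @\<^sub>v x) + (0\<^sub>v k @\<^sub>v y) = (0\<^sub>v k + 0\<^sub>v k) @\<^sub>v (x + y)"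
        using xy by (intro add) auto
      finally show "x + y \<in> ?Y" using xy by auto
    next
      fix c x assume x: "x \<in> ?Y"
      then have "c \<cdot>\<^sub>v (0\<^sub>v k @\<^sub>v x) \<in> W" using W'(4) by auto
      then show "c \<cdot>\<^sub>v x \<in> ?Y" using x by (auto simp: smult smult0)
    qed (use W'(2) in auto)
    have Xst: "?J *\<^sub>v x \<in> ?X" if "x \<in> ?X" for x
    proof -
      have "?K *\<^sub>v (x @\<^sub>v 0\<^sub>v ?m) = ?J *\<^sub>v x @\<^sub>v 0\<^sub>v ?m" using that K N0 by simp
      then have "?J *\<^sub>v x @\<^sub>v 0\<^sub>v ?m \<in> W" using that st by force
      then show ?thesis using that mult_mat_vec_carrier[OF J] by simp
    qed
    have Yst: "\<forall>y\<in>?Y. ?N *\<^sub>v y \<in> ?Y"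
    proof
      fix y assume y: "y \<in> ?Y"
      then have "?K *\<^sub>v (0\<^sub>v k @\<^sub>v y) = 0\<^sub>v k @\<^sub>v ?N *\<^sub>v y" using K J0 by simp
      then have "0\<^sub>v k @\<^sub>v ?N *\<^sub>v y \<in> W" using y st by force
      then show "?N *\<^sub>v y \<in> ?Y" using y mult_mat_vec_carrier[OF N] by simp
    qed
    have "snd ` set ps \<subseteq> ?Y" using gW ps(2) by (auto simp: image_subset_iff)
    then have Yall: "carrier_vec ?m \<subseteq> ?Y" by (rule ps(3)[OF Y Yst])
    have "unit_vec k i \<in> ?X" if i: "i < k" for i
    proof -
      have "e \<in> ?X" using gW e by auto
      then have "(((*\<^sub>v) ?J) ^^ (k - 1 - i)) e \<in> ?X"
        using Xst by (intro funpow_stable) auto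
      also have "(((*\<^sub>v) ?J) ^^ (k - 1 - i)) e = unit_vec k i"
      proof -
        have "k - 1 < k" "k - 1 - i \<le> k - 1" "k - 1 - (k - 1 - i) = i" using i by auto
        then show ?thesis unfolding e_def by (simp only: jordan_block_funpow_unit_vec if_True)
      qed
      finally show ?thesis .
    qed
    then have "set (unit_vecs k) \<subseteq> ?X" unfolding unit_vecs_def by auto
    then have Xall: "carrier_vec k \<subseteq> ?X"
      using vec_space.span_subset_subspace[OF X] vec_space.span_unit_vecs_is_carrier by blast
    show "carrier_vec (sum_list (k # l)) \<subseteq> W"
    proof
      fix v :: "complex vec" assume "v \<in> carrier_vec (sum_list (k # l))"
      then have v: "v = vec_first v k @\<^sub>v vec_last v ?m" by simp
      let ?x = "vec_first v k" and ?y = "vec_last v ?m"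
      have "(?x @\<^sub>v 0\<^sub>v ?m) + (0\<^sub>v k @\<^sub>v ?y) \<in> W"
        using Xall Yall W'(3) by (metis (no_types, lifting) mem_Collect_eq subsetD
            vec_first_carrier vec_last_carrier)
      also have "(?x @\<^sub>v 0\<^sub>v ?m) + (0\<^sub>v k @\<^sub>v ?y) = (?x + 0\<^sub>v k) @\<^sub>v (0\<^sub>v ?m + ?y)"
        by (rule add) auto
      also have "\<dots> = v" using v by simp
      finally show "v \<in> W" .
    qed
  qed
qed

section \<open>Peterson varieties\<close>

lemma nilpotent_jordan_carrier_partition:
  "is_partition n l \<Longrightarrow> nilpotent_jordan l \<in> carrier_mat n n"
  using nilpotent_jordan_carrier[of l] by (simp add: is_partition_def is_composition_def)

lemma Fl_mono: "F \<in> Fl n \<Longrightarrow> i < n \<Longrightarrow> F ! i \<subseteq> F ! Suc i"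
  by (auto simp: Fl_def)

text \<open>At a partial sum of \<open>b\<close> that is not one of \<open>c\<close>, stability
  implies the weaker condition because flag members increase. Such an index is below
  \<open>n\<close>, as \<open>n\<close> is a partial sum of \<open>c\<close>.\<close>

lemma Pet_antimono:
  assumes "1 \<le> n" "is_composition n b" "is_composition n c" "refines b c"
  shows "Pet n l b \<subseteq> Pet n l c"
proof
  fix F assume F: "F \<in> Pet n l b"
  then have Fl: "F \<in> Fl n" by (simp add: Pet_def)
  have "n \<in> PS c" using assms(1,3) sum_list_in_PS[of c] by (cases c) (auto simp: is_composition_def)
  then have lt: "i < n" if "i \<in> {1..n} - PS c" for i using that by (cases "i = n") auto
  show "F \<in> Pet n l c"
    unfolding Pet_def
  proof (intro CollectI conjI ballI)
    show "(*\<^sub>v) (nilpotent_jordan l) ` (F ! i) \<subseteq> F ! i" if "i \<in> PS c" for i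
      using that F assms(4) unfolding Pet_def refines_def by blast
    show "(*\<^sub>v) (nilpotent_jordan l) ` (F ! i) \<subseteq> F ! (i + 1)" if i: "i \<in> {1..n} - PS c" for i
    proof (cases "i \<in> PS b")
      case True
      then have "(*\<^sub>v) (nilpotent_jordan l) ` (F ! i) \<subseteq> F ! i"
        using F unfolding Pet_def by blast
      then show ?thesis using Fl_mono[OF Fl lt[OF i]] by simp
    next
      case False
      then show ?thesis using F i unfolding Pet_def by blast
    qed
  qed (rule Fl)
qed

lemma Pet_stable_composition:
  assumes n: "1 \<le> n" and l: "is_partition n l" and a: "is_composition n a" and F: "F \<in> Pet n l a"
  shows "\<exists>b \<in> dominated_set n l \<inter> refinements n a. F \<in> Pet n l b"
proof -
  interpret vec_space "TYPE(complex)" n .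
  let ?N = "nilpotent_jordan l"
  have N: "?N \<in> carrier_mat n n" by (rule nilpotent_jordan_carrier_partition[OF l])
  have sl: "sum_list l = n" using l by (simp add: is_partition_def is_composition_def)
  have Fl: "F \<in> Fl n" using F by (simp add: Pet_def)
  \<comment> \<open>All stable indices are collected, not only those prescribed by \<open>a\<close>:
    the rank bound relies on instability at every index outside \<open>PS b\<close>. The full space
    is stable, so \<open>n\<close> belongs to \<open>T\<close>.\<close>
  define T where "T = {i \<in> {1..n}. (*\<^sub>v) ?N ` (F ! i) \<subseteq> F ! i}"
  have "n \<in> T" using n Fl N by (auto simp: T_def Fl_def)
  then obtain b where b: "is_composition n b" "PS b = T"
    using exists_composition_PS[OF n, of T] unfolding T_def by blast
  have aT: "PS a \<subseteq> T" using F PS_subset[OF a] by (auto simp: T_def Pet_def)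
  have Fb: "F \<in> Pet n l b" unfolding Pet_def
  proof (intro CollectI conjI ballI)
    show "(*\<^sub>v) ?N ` (F ! i) \<subseteq> F ! i" if "i \<in> PS b" for i
      using that by (simp add: b(2) T_def)
    show "(*\<^sub>v) ?N ` (F ! i) \<subseteq> F ! (i + 1)" if "i \<in> {1..n} - PS b" for i
    proof -
      have "i \<in> {1..n} - PS a" using that aT b(2) by blast
      then show ?thesis using F unfolding Pet_def by blast
    qed
  qed (rule Fl)
  obtain ps where ps: "map fst ps = l"
    "\<And>z. z \<in> set ps \<Longrightarrow> snd z \<in> carrier_vec n \<and> (((*\<^sub>v) ?N) ^^ fst z) (snd z) = 0\<^sub>v n"
    "\<And>W. VectorSpace.subspace class_ring W V \<Longrightarrow>
      (\<forall>x \<in> W. ?N *\<^sub>v x \<in> W) \<Longrightarrow> snd ` set ps \<subseteq> W \<Longrightarrow> carrier_vec n \<subseteq> W"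
    using nilpotent_jordan_generators[of l] unfolding sl by blast
  have "(\<Sum>x\<leftarrow>b. x - k) \<le> (\<Sum>x\<leftarrow>l. x - k)" for k
  proof -
    have "(\<Sum>x\<leftarrow>b. x - k) \<le> (\<Sum>z\<leftarrow>ps. fst z - k)"
    proof (rule flag_truncated_sum_le[OF N _ _ _ b(1) _ _ ps(2,3), where G = "\<lambda>i. F ! i"])
      show "VectorSpace.subspace class_ring (F ! i) V" if "i \<le> n" for i
        using Fl that by (auto simp: Fl_def has_subspace_dim_def)
      show "vectorspace.dim class_ring (V\<lparr>carrier := F ! i\<rparr>) = i" if "i \<le> n" for i
        using Fl that by (auto simp: Fl_def has_subspace_dim_def)
      show "F ! i \<subset> F ! Suc i" if "i < n" for i
        using Fl that by (auto simp: Fl_def)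
      show "i \<in> PS b \<longleftrightarrow> i \<in> {1..n} \<and> (*\<^sub>v) ?N ` (F ! i) \<subseteq> F ! i" for i
        by (simp add: b(2) T_def)
      show "(*\<^sub>v) ?N ` (F ! i) \<subseteq> F ! Suc i" if "i \<in> {1..n} - PS b" for i
        using Fb that by (simp add: Pet_def)
    qed
    also have "\<dots> = (\<Sum>x\<leftarrow>l. x - k)" unfolding ps(1)[symmetric] by (simp add: comp_def)
    finally show ?thesis .
  qed
  then have "dominated_by b l" using dominated_by_threshold b(1) l by blast
  then show ?thesis using b aT Fb
    by (auto simp: dominated_set_def refinements_def refines_def)
qed

text \<open>The flag is spanned by the prefixes of an adapted basis \<open>ws\<close>. At an index
  \<open>i\<close> outside \<open>PS b\<close>, the vector \<open>ws ! (i - 1)\<close> lies in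
  \<open>F ! i\<close> but its image \<open>ws ! i\<close> does not, so no further index is
  stable.\<close>

lemma exists_flag_stable_exactly:
  assumes l: "is_partition n l" and b: "is_composition n b" and dom: "dominated_by b l"
  shows "\<exists>F \<in> Pet n l b. \<forall>i \<in> {1..n}. (*\<^sub>v) (nilpotent_jordan l) ` (F ! i) \<subseteq> F ! i \<longrightarrow> i \<in> PS b"
proof -
  interpret vec_space "TYPE(complex)" n .
  let ?N = "nilpotent_jordan l"
  have N: "?N \<in> carrier_mat n n" by (rule nilpotent_jordan_carrier_partition[OF l])
  have sl: "sum_list l = n" using l by (simp add: is_partition_def is_composition_def)
  have sb: "sum_list b = n" using b by (simp add: is_composition_def)
  obtain ps where ps: "map fst ps = l"
    "\<And>z. z \<in> set ps \<Longrightarrow> snd z \<in> carrier_vec n \<and> (((*\<^sub>v) ?N) ^^ fst z) (snd z) = 0\<^sub>v n"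
    "\<And>W. VectorSpace.subspace class_ring W V \<Longrightarrow>
      (\<forall>x \<in> W. ?N *\<^sub>v x \<in> W) \<Longrightarrow> snd ` set ps \<subseteq> W \<Longrightarrow> carrier_vec n \<subseteq> W"
    using nilpotent_jordan_generators[of l] unfolding sl by blast
  have N0: "?N *\<^sub>v 0\<^sub>v n = 0\<^sub>v n" using N by auto
  have "\<exists>ws. length ws = sum_list b \<and> set ws \<subseteq> carrier_vec n \<and>
    carrier_vec n \<subseteq> span (set ([] @ ws)) \<and>
    (\<forall>i \<in> PS b. stable ?N (span (set ([] @ take i ws)))) \<and>
    (\<forall>i \<in> {1..sum_list b} - PS b. ws ! i = ?N *\<^sub>v (ws ! (i - 1)))"
  proof (rule exists_adapted_spanning_list[OF N, of ps])
    show "sorted_wrt (\<ge>) (map fst ps)" using l by (simp add: ps(1) is_partition_def)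
    show "snd z \<in> carrier_vec n \<and> (((*\<^sub>v) ?N) ^^ fst z) (snd z) \<in> span (set [])" if "z \<in> set ps" for z
      using ps(2)[OF that] span_zero by simp
    show "stable ?N (span (set []))" using N0 by (simp add: stable_def span_empty)
    show "carrier_vec n \<subseteq> W" if "VectorSpace.subspace class_ring W V" "stable ?N W"
      "snd ` set ps \<subseteq> W" for W
      using ps(3) that by (simp add: stable_def)
    show "is_composition (sum_list (map fst ps)) b" using b sl by (simp add: ps(1))
    show "sum_mset S \<le> sum_list (take (size S) (map fst ps))" if "S \<subseteq># mset b" for S
      unfolding ps(1) by (rule dominated_by_submset[OF dom that])
  qed simp
  then obtain ws where ws: "length ws = n" "set ws \<subseteq> carrier_vec n" "carrier_vec n \<subseteq> span (set ws)"
    "\<And>i. i \<in> PS b \<Longrightarrow> stable ?N (span (set (take i ws)))"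
    "\<And>i. i \<in> {1..n} - PS b \<Longrightarrow> ws ! i = ?N *\<^sub>v (ws ! (i - 1))"
    unfolding sb by auto
  have span_all: "span (set ws) = carrier_vec n"
    using ws(2,3) span_is_subset2[OF ws(2)] by blast
  \<comment> \<open>\<open>n\<close> vectors spanning an \<open>n\<close>-dimensional space form a
    basis; repeated entries would make their set too small, so \<open>ws\<close> is
    distinct.\<close>
  have "card (set ws) \<le> dim" using card_length[of ws] ws(1) dim_is_n by simp
  then have basis: "basis (set ws)" using dim_gen_is_basis[of "set ws"] ws(2) span_all by simp
  then have "card (set ws) = n" using dim_basis[OF _ basis] dim_is_n by simp
  then have dist: "distinct ws" using ws(1) by (simp add: card_distinct)
  have indpt: "lin_indpt (set (take i ws))" for i
    using basis subset_li_is_li[OF _ set_take_subset] unfolding basis_def by blast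
  have car: "set (take i ws) \<subseteq> carrier_vec n" for i using ws(2) set_take_subset by fast
  have wcar: "ws ! i \<in> carrier_vec n" if "i < n" for i using that ws(1,2) by auto
  define F where "F = map (\<lambda>i. span (set (take i ws))) [0..<n+1]"
  have Fi: "F ! i = span (set (take i ws))" if "i \<le> n" for i
    using that unfolding F_def by (simp del: upt_Suc)
  have sub: "VectorSpace.subspace class_ring (span (set (take i ws))) V" for i
    by (rule dim_span_indpt(1)[OF _ car indpt]) simp
  have own: "set (take i ws) \<subseteq> span (set (take i ws))" for i by (rule in_own_span[OF car])
  have dimF: "vectorspace.dim class_ring (V\<lparr>carrier := span (set (take i ws))\<rparr>) = i" if "i \<le> n" for i
    using dim_span_indpt(2)[OF _ car indpt, of i] dist that ws(1) by (simp add: distinct_card)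
  have mono: "span (set (take i ws)) \<subseteq> span (set (take (Suc i) ws))" for i
    by (intro span_is_monotone set_take_subset_set_take) simp
  have new: "ws ! i \<notin> span (set (take i ws))" if "i < n" for i
  proof
    assume "ws ! i \<in> span (set (take i ws))"
    moreover have "ws ! i \<notin> set (take i ws)"
      using dist that ws(1) by (auto simp: in_set_conv_nth nth_eq_iff_index_eq)
    ultimately have "lin_dep (set (take i ws) \<union> {ws ! i})"
      using lin_dep_iff_in_span[OF _ indpt[of i], of "ws ! i"] car[of i] wcar[OF that] by simp
    moreover have "set (take i ws) \<union> {ws ! i} = set (take (Suc i) ws)"
      using that ws(1) by (simp add: take_Suc_conv_app_nth)
    ultimately show False using indpt[of "Suc i"] by simp
  qed
  have next_in: "ws ! i \<in> span (set (take (Suc i) ws))" if "i < n" for i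
    using own[of "Suc i"] that ws(1) by (auto simp: take_Suc_conv_app_nth)
  have PSn: "PS b \<subseteq> {1..n}" by (rule PS_subset[OF b])
  have nPS: "n \<in> PS b" if "1 \<le> n"
    using that sb sum_list_in_PS[of b] by (cases b) auto
  have hess: "?N *\<^sub>v x \<in> span (set (take (Suc i) ws))" if i: "i \<le> n" and x: "x \<in> span (set (take i ws))" for i x
  proof (rule span_stable[OF N car _ sub x])
    fix y assume "y \<in> set (take i ws)"
    then obtain j where j: "j < i" "y = ws ! j" using i ws(1) by (auto simp: in_set_conv_nth)
    have "?N *\<^sub>v y \<in> span (set (take (Suc (Suc j)) ws))"
    \<comment> \<open>At the end of a block the prefix is stable; elsewhere the image is the next
      basis vector. Either way one extra vector suffices.\<close>
    proof (cases "Suc j \<in> PS b")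
      case True
      then have "?N *\<^sub>v y \<in> span (set (take (Suc j) ws))"
        using ws(4)[OF True] next_in[of j] j i by (simp add: stable_def)
      then show ?thesis using mono by blast
    next
      case False
      then have "Suc j \<noteq> n" using nPS by auto
      then show ?thesis using ws(5)[of "Suc j"] next_in[of "Suc j"] j i False by simp
    qed
    also have "span (set (take (Suc (Suc j)) ws)) \<subseteq> span (set (take (Suc i) ws))"
      using j by (intro span_is_monotone set_take_subset_set_take) simp
    finally show "?N *\<^sub>v y \<in> span (set (take (Suc i) ws))" .
  qed
  have "F \<in> Fl n"
    unfolding Fl_def
  proof (intro CollectI conjI allI impI)
    show "length F = n + 1" by (simp add: F_def)
    show "has_subspace_dim n (F ! i) i" if "i \<le> n" for i
      unfolding has_subspace_dim_def using Fi[OF that] sub dimF[OF that] by simp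
    show "F ! i \<subset> F ! (i + 1)" if "i < n" for i
      using Fi[of i] Fi[of "Suc i"] mono[of i] new[OF that] next_in[OF that] that by auto
    show "F ! n = carrier_vec n" using Fi[of n] ws(1) span_all by simp
  qed
  moreover have "(*\<^sub>v) ?N ` (F ! i) \<subseteq> F ! i" if "i \<in> PS b" for i
    using ws(4)[OF that] PSn that Fi[of i] by (auto simp: stable_def)
  moreover have "(*\<^sub>v) ?N ` (F ! i) \<subseteq> F ! (i + 1)" if i: "i \<in> {1..n} - PS b" for i
  proof -
    have "i \<noteq> n" using i nPS by auto
    then show ?thesis using hess[of i] Fi[of i] Fi[of "Suc i"] i by auto
  qed
  moreover have "i \<in> PS b" if i: "i \<in> {1..n}" and st: "(*\<^sub>v) ?N ` (F ! i) \<subseteq> F ! i" for i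
  proof (rule ccontr)
    assume nin: "i \<notin> PS b"
    then have lt: "i < n" using i nPS by (cases "i = n") auto
    have "ws ! (i - 1) \<in> F ! i" using next_in[of "i - 1"] i Fi[of i] by auto
    then have "?N *\<^sub>v (ws ! (i - 1)) \<in> F ! i" using st by auto
    then show False using ws(5)[of i] nin i new[OF lt] Fi[of i] by auto
  qed
  ultimately show ?thesis unfolding Pet_def by blast
qed

theorem theorem1p2:
  fixes n :: nat and l a :: "nat list"
  assumes "1 \<le> n"
    and "is_partition n l"
    and "is_composition n a"
    and "\<not> dominated_by a l"
  shows "Pet n l a = (\<Union>b \<in> coarsest (dominated_set n l \<inter> refinements n a). Pet n l b) \<and>
    (\<forall>b \<in> coarsest (dominated_set n l \<inter> refinements n a).
     \<forall>c \<in> coarsest (dominated_set n l \<inter> refinements n a).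
       b \<noteq> c \<longrightarrow> \<not> Pet n l b \<subseteq> Pet n l c)"
proof -
  let ?A = "dominated_set n l \<inter> refinements n a"
  have comp: "is_composition n b" if "b \<in> ?A" for b
    using that by (simp add: dominated_set_def)
  have fin: "finite ?A"
    by (rule finite_subset[OF _ finite_compositions[of n]]) (use comp in auto)
  have crs: "b \<in> ?A" if "b \<in> coarsest ?A" for b
    using that by (simp add: coarsest_def)
  have "Pet n l a \<subseteq> (\<Union>b \<in> coarsest ?A. Pet n l b)"
  proof
    fix F assume "F \<in> Pet n l a"
    then obtain b where b: "b \<in> ?A" "F \<in> Pet n l b"
      using Pet_stable_composition[OF assms(1-3)] by blast
    obtain c where c: "c \<in> coarsest ?A" "refines b c"
      using refines_coarsest[OF fin comp b(1)] by blast
    then show "F \<in> (\<Union>b \<in> coarsest ?A. Pet n l b)"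
      using Pet_antimono[OF assms(1) comp[OF b(1)] comp[OF crs[OF c(1)]] c(2)] b(2) by blast
  qed
  moreover have "Pet n l b \<subseteq> Pet n l a" if b: "b \<in> coarsest ?A" for b
    using Pet_antimono[OF assms(1) comp[OF crs[OF b]] assms(3)] crs[OF b]
    by (simp add: refinements_def)
  moreover have "\<not> Pet n l b \<subseteq> Pet n l c"
    if b: "b \<in> coarsest ?A" and c: "c \<in> coarsest ?A" and "b \<noteq> c" for b c
  proof
    assume sub: "Pet n l b \<subseteq> Pet n l c"
    \<comment> \<open>A flag whose stable indices are exactly \<open>PS b\<close> tests the
      inclusion: lying in the variety of \<open>c\<close> makes every element of \<open>PS c\<close>
      stable.\<close>
    have "dominated_by b l" using crs[OF b] by (simp add: dominated_set_def)
    then obtain F where F: "F \<in> Pet n l b"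
      "\<And>i. i \<in> {1..n} \<Longrightarrow> (*\<^sub>v) (nilpotent_jordan l) ` (F ! i) \<subseteq> F ! i \<Longrightarrow> i \<in> PS b"
      using exists_flag_stable_exactly[OF assms(2) comp[OF crs[OF b]]] by blast
    have "PS c \<subseteq> PS b"
    proof
      fix i assume i: "i \<in> PS c"
      then have "(*\<^sub>v) (nilpotent_jordan l) ` (F ! i) \<subseteq> F ! i"
        using sub F(1) by (auto simp: Pet_def)
      then show "i \<in> PS b" using F(2) i PS_subset[OF comp[OF crs[OF c]]] by blast
    qed
    then show False using b crs[OF c] \<open>b \<noteq> c\<close> by (auto simp: coarsest_def refines_def)
  qed
  ultimately show ?thesis by blast
qed

end
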